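(* Let $\sigma$ be a sequent. (1) If $\sigma$ is valid over the class of epistemic frames, then $\sigma$ has a non-wellfounded proof in $\mathrm{nICK}$. (2) If $\sigma$ is valid over the class of reflexive frames, then $\sigma$ has a non-wellfounded proof in $\mathrm{nICKT}$. (3) If $\sigma$ is valid over the class of S4 frames, then $\sigma$ has a non-wellfounded proof in $\mathrm{nICKS4}$.
   Context: Formulae over a finite non-empty set $\mathsf{A}$ of agents and atoms $\mathrm{Prop}$: $\varphi ::= \bot \mid p \mid \varphi\wedge\varphi\mid\varphi\vee\varphi\mid\varphi\to\varphi\mid K_a\varphi\mid C\varphi$. Semantics: an epistemic frame $(\mathcal{W},\leq,\{R_a\})$ has $\mathcal{W}\neq\emptyset$, $\leq$ a partial order, $R_a\subseteq\mathcal{W}^2$ with triangle confluence ($w\leq v$, $vR_au$ imply $wR_au$); reflexive/S4 frames have each $R_a$ reflexive / reflexive and transitive. Models add a $\leq$-monotone valuation; $w\models\varphi\to\psi$ iff for all $v\geq w$, $v\models\varphi$ implies $v\models\psi$; $w\models K_a\varphi$ iff all $R_a$-successors satisfy $\varphi$; $w\models C\varphi$ iff all $R^*$-successors satisfy $\varphi$ ($R^*$ reflexive–transitive closure of $\bigcup_aR_a$); atoms, $\bot,\wedge,\vee$ as usual. Sequents: annotated formulae $\varphi^x$, $x\in\{\mathsf{u},\mathsf{f}\}$; $\Gamma^-=\{\varphi:\varphi^x\in\Gamma\}$, $K_a\Gamma=\{(K_a\psi)^x:\psi^x\in\Gamma\}$. A sequent $\Gamma\Rightarrow\Delta$ has finite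 sets of annotated formulae, all of $\Gamma$ unfocused, at most one focused formula in $\Delta$, which must be of form $C\psi$ or $K_aC\psi$; it is valid over a class if $\bigwedge\Gamma^-\to\bigvee\Delta^-$ is (empty conjunction $\bot\to\bot$, empty disjunction $\bot$). Rules (premises / conclusion; sets possibly empty; $x\in\{\mathsf{u},\mathsf{f}\}$; premises and conclusion must be sequents): axioms id: $\Gamma,\varphi^{\mathsf{u}}\Rightarrow\varphi^x,\Delta$ and $\bot$: $\Gamma,\bot^{\mathsf{u}}\Rightarrow\Delta$; $\wedge$L: $\Gamma,\varphi^{\mathsf{u}},\psi^{\mathsf{u}}\Rightarrow\Delta$ / $\Gamma,(\varphi\wedge\psi)^{\mathsf{u}}\Rightarrow\Delta$; $\wedge$R: $\Gamma\Rightarrow\varphi^{\mathsf{u}},\Delta$, $\Gamma\Rightarrow\psi^{\mathsf{u}},\Delta$ / $\Gamma\Rightarrow(\varphi\wedge\psi)^{\mathsf{u}},\Delta$; $\vee$L: $\Gamma,\varphi^{\mathsf{u}}\Rightarrow\Delta$, $\Gamma,\psi^{\mathsf{u}}\Rightarrow\Delta$ / $\Gamma,(\varphi\vee\psi)^{\mathsf{u}}\Rightarrow\Delta$; $\vee$R: $\Gamma\Rightarrow\varphi^{\mathsf{u}},\psi^{\mathsf{u}},\Delta$ / $\Gamma\Rightarrow(\varphi\vee\psi)^{\mathsf{u}},\Delta$; $\to$L: $\Gamma\Rightarrow\varphi^{\mathsf{u}},\Delta$, $\Gamma,\psi^{\mathsf{u}}\Rightarrow\Delta$ / $\Gamma,(\varphi\to\psi)^{\mathsf{u}}\Rightarrow\Delta$;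 $\to$R: $\Gamma,\varphi^{\mathsf{u}}\Rightarrow\psi^{\mathsf{u}}$ / $\Gamma\Rightarrow(\varphi\to\psi)^{\mathsf{u}},\Delta$; u: $\Gamma\Rightarrow\varphi^{\mathsf{u}},\Delta$ / $\Gamma\Rightarrow\varphi^{\mathsf{f}},\Delta$; f: $\Gamma\Rightarrow\varphi^{\mathsf{f}},\Delta$ / $\Gamma\Rightarrow\varphi^{\mathsf{u}},\Delta$; $\mathsf{K}_a$: $\Gamma\Rightarrow\varphi^x$ / $\Pi,K_a\Gamma\Rightarrow(K_a\varphi)^x,\Sigma$; $\mathsf{T}_a$: $\Gamma,\varphi^{\mathsf{u}}\Rightarrow\Delta$ / $\Gamma,(K_a\varphi)^{\mathsf{u}}\Rightarrow\Delta$; $\mathsf{S4}_a$: $K_a\Gamma\Rightarrow\varphi^x$ / $\Pi,K_a\Gamma\Rightarrow(K_a\varphi)^x,\Sigma$; CL: $\Gamma,\varphi^{\mathsf{u}},\{(K_aC\varphi)^{\mathsf{u}}\}_{a\in\mathsf{A}}\Rightarrow\Delta$ / $\Gamma,(C\varphi)^{\mathsf{u}}\Rightarrow\Delta$; CR: $\Gamma\Rightarrow\varphi^{\mathsf{u}},\Delta$ and for each $a$, $\Gamma\Rightarrow(K_aC\varphi)^x,\Delta$ / $\Gamma\Rightarrow(C\varphi)^x,\Delta$ ($C\varphi$ principal). Calculi: $\mathrm{nICK}$ = id, $\bot$, $\wedge$L/R, $\vee$L/R, $\to$L/R, u, f, $\mathsf{K}_a$, CL, CR; $\mathrm{nICKT}$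 adds $\mathsf{T}_a$; $\mathrm{nICKS4}$ is $\mathrm{nICKT}$ with $\mathsf{K}_a$ replaced by $\mathsf{S4}_a$. A non-wellfounded pre-proof of $\sigma$ is a finite or countably infinite tree labelled by sequents with root $\sigma$, each inner node with its children forming a rule instance. It is a non-wellfounded proof if every leaf is an axiom instance and every infinite branch has a suffix in which every sequent has a formula in focus and which passes through infinitely many CR instances whose principal formula is in focus. *)

theory Defs
  imports Main "HOL-Library.Infinite_Set"
begin

text \<open>The agents are the elements of a finite type \<open>'a\<close> (types are non-empty), the atoms those of an
  arbitrary type \<open>'p\<close>.\<close>

datatype ('p, 'a) fm =
    Bot
  | Atom 'p
  | And "('p, 'a) fm" "('p, 'a) fm"
  | Or "('p, 'a) fm" "('p, 'a) fm"
  | Imp "('p, 'a) fm" "('p, 'a) fm"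
  | Know 'a "('p, 'a) fm"
  | Common "('p, 'a) fm"

record ('w, 'a) frame =
  worlds :: "'w set"
  le :: "('w \<times> 'w) set"
  acc :: "'a \<Rightarrow> ('w \<times> 'w) set"

text \<open>HOL cannot quantify over all types inside a formula, so a class of frames consists of the frames
  whose worlds form a subset of a given type \<open>'w\<close>. Validity over such a class is a hypothesis of
  completeness, which therefore becomes stronger when \<open>'w\<close> is restricted; it may fail when \<open>'w\<close> is finite.\<close>

definition epistemic_frames :: "('w, 'a) frame set" where
  "epistemic_frames = {F. worlds F \<noteq> {} \<and> partial_order_on (worlds F) (le F) \<and>
     (\<forall>a. acc F a \<subseteq> worlds F \<times> worlds F) \<and>
     (\<forall>a w v u. (w, v) \<in> le F \<longrightarrow> (v, u) \<in> acc F a \<longrightarrow> (w, u) \<in> acc F a)}"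

definition reflexive_frames :: "('w, 'a) frame set" where
  "reflexive_frames = {F \<in> epistemic_frames. \<forall>a. refl_on (worlds F) (acc F a)}"

definition S4_frames :: "('w, 'a) frame set" where
  "S4_frames = {F \<in> epistemic_frames. \<forall>a. refl_on (worlds F) (acc F a) \<and> trans (acc F a)}"

definition monotone_valuation :: "('w, 'a) frame \<Rightarrow> ('w \<Rightarrow> 'p set) \<Rightarrow> bool" where
  "monotone_valuation F V \<longleftrightarrow> (\<forall>w v. (w, v) \<in> le F \<longrightarrow> V w \<subseteq> V v)"

primrec sat :: "('w, 'a) frame \<Rightarrow> ('w \<Rightarrow> 'p set) \<Rightarrow> 'w \<Rightarrow> ('p, 'a) fm \<Rightarrow> bool" where
  "sat F V w Bot \<longleftrightarrow> False"
| "sat F V w (Atom p) \<longleftrightarrow> p \<in> V w"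
| "sat F V w (And \<phi> \<psi>) \<longleftrightarrow> sat F V w \<phi> \<and> sat F V w \<psi>"
| "sat F V w (Or \<phi> \<psi>) \<longleftrightarrow> sat F V w \<phi> \<or> sat F V w \<psi>"
| "sat F V w (Imp \<phi> \<psi>) \<longleftrightarrow> (\<forall>v. (w, v) \<in> le F \<longrightarrow> sat F V v \<phi> \<longrightarrow> sat F V v \<psi>)"
| "sat F V w (Know a \<phi>) \<longleftrightarrow> (\<forall>v. (w, v) \<in> acc F a \<longrightarrow> sat F V v \<phi>)"
| "sat F V w (Common \<phi>) \<longleftrightarrow> (\<forall>v. (w, v) \<in> (\<Union>a. acc F a)\<^sup>* \<longrightarrow> sat F V v \<phi>)"

definition valid_fm :: "('w, 'a) frame set \<Rightarrow> ('p, 'a) fm \<Rightarrow> bool" where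
  "valid_fm \<F> \<phi> \<longleftrightarrow>
     (\<forall>F\<in>\<F>. \<forall>V. monotone_valuation F V \<longrightarrow> (\<forall>w\<in>worlds F. sat F V w \<phi>))"

datatype annotation = Unfocused | Focused

type_synonym ('p, 'a) afm = "('p, 'a) fm \<times> annotation"

type_synonym ('p, 'a) sequent = "('p, 'a) afm set \<times> ('p, 'a) afm set"

abbreviation unf :: "('p, 'a) fm \<Rightarrow> ('p, 'a) afm" where
  "unf \<phi> \<equiv> (\<phi>, Unfocused)"

abbreviation foc :: "('p, 'a) fm \<Rightarrow> ('p, 'a) afm" where
  "foc \<phi> \<equiv> (\<phi>, Focused)"

definition focusable :: "('p, 'a) fm \<Rightarrow> bool" where
  "focusable \<phi> \<longleftrightarrow> (\<exists>\<psi>. \<phi> = Common \<psi>) \<or> (\<exists>a \<psi>. \<phi> = Know a (Common \<psi>))"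

fun is_sequent :: "('p, 'a) sequent \<Rightarrow> bool" where
  "is_sequent (\<Gamma>, \<Delta>) \<longleftrightarrow> finite \<Gamma> \<and> finite \<Delta> \<and>
     (\<forall>\<phi>. foc \<phi> \<notin> \<Gamma>) \<and>
     (\<forall>\<phi> \<psi>. foc \<phi> \<in> \<Delta> \<longrightarrow> foc \<psi> \<in> \<Delta> \<longrightarrow> \<phi> = \<psi>) \<and>
     (\<forall>\<phi>. foc \<phi> \<in> \<Delta> \<longrightarrow> focusable \<phi>)"

definition has_focus :: "('p, 'a) sequent \<Rightarrow> bool" where
  "has_focus \<sigma> \<longleftrightarrow> (\<exists>\<phi>. foc \<phi> \<in> snd \<sigma>)"

text \<open>Conjunctions and disjunctions of finite sets are taken in an arbitrary, but fixed, order.\<close>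

fun conj_list :: "('p, 'a) fm list \<Rightarrow> ('p, 'a) fm" where
  "conj_list [] = Imp Bot Bot"
| "conj_list [\<phi>] = \<phi>"
| "conj_list (\<phi> # \<psi> # xs) = And \<phi> (conj_list (\<psi> # xs))"

fun disj_list :: "('p, 'a) fm list \<Rightarrow> ('p, 'a) fm" where
  "disj_list [] = Bot"
| "disj_list [\<phi>] = \<phi>"
| "disj_list (\<phi> # \<psi> # xs) = Or \<phi> (disj_list (\<psi> # xs))"

definition enumeration :: "'b set \<Rightarrow> 'b list" where
  "enumeration S = (SOME xs. set xs = S \<and> distinct xs)"

definition Big_And :: "('p, 'a) fm set \<Rightarrow> ('p, 'a) fm" where
  "Big_And S = conj_list (enumeration S)"

definition Big_Or :: "('p, 'a) fm set \<Rightarrow> ('p, 'a) fm" where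
  "Big_Or S = disj_list (enumeration S)"

fun valid :: "('w, 'a) frame set \<Rightarrow> ('p, 'a) sequent \<Rightarrow> bool" where
  "valid \<F> (\<Gamma>, \<Delta>) \<longleftrightarrow> valid_fm \<F> (Imp (Big_And (fst ` \<Gamma>)) (Big_Or (fst ` \<Delta>)))"

definition Know_set :: "'a \<Rightarrow> ('p, 'a) afm set \<Rightarrow> ('p, 'a) afm set" where
  "Know_set a \<Gamma> = {(Know a \<psi>, x) | \<psi> x. (\<psi>, x) \<in> \<Gamma>}"

text \<open>The annotation in \<open>R_CR x\<close> is that of the principal formula.\<close>

datatype rule = Ax_Id | Ax_Bot | R_AndL | R_AndR | R_OrL | R_OrR | R_ImpL | R_ImpR | R_U | R_F
  | R_K | R_T | R_S4 | R_CL | R_CR annotation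

text \<open>A comma is set union, so that \<open>\<Gamma>, \<phi>\<close> is \<open>insert \<phi> \<Gamma>\<close> and a principal formula may also occur
  in its context. In \<open>R_CR\<close> the list \<open>as\<close> enumerates the agents.\<close>

inductive schema ::
  "rule \<Rightarrow> ('p, 'a::finite) sequent list \<Rightarrow> ('p, 'a) sequent \<Rightarrow> bool" where
  "schema Ax_Id [] (insert (unf \<phi>) \<Gamma>, insert (\<phi>, x) \<Delta>)"
| "schema Ax_Bot [] (insert (unf Bot) \<Gamma>, \<Delta>)"
| "schema R_AndL [(insert (unf \<phi>) (insert (unf \<psi>) \<Gamma>), \<Delta>)] (insert (unf (And \<phi> \<psi>)) \<Gamma>, \<Delta>)"
| "schema R_AndR [(\<Gamma>, insert (unf \<phi>) \<Delta>), (\<Gamma>, insert (unf \<psi>) \<Delta>)]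
    (\<Gamma>, insert (unf (And \<phi> \<psi>)) \<Delta>)"
| "schema R_OrL [(insert (unf \<phi>) \<Gamma>, \<Delta>), (insert (unf \<psi>) \<Gamma>, \<Delta>)]
    (insert (unf (Or \<phi> \<psi>)) \<Gamma>, \<Delta>)"
| "schema R_OrR [(\<Gamma>, insert (unf \<phi>) (insert (unf \<psi>) \<Delta>))] (\<Gamma>, insert (unf (Or \<phi> \<psi>)) \<Delta>)"
| "schema R_ImpL [(\<Gamma>, insert (unf \<phi>) \<Delta>), (insert (unf \<psi>) \<Gamma>, \<Delta>)]
    (insert (unf (Imp \<phi> \<psi>)) \<Gamma>, \<Delta>)"
| "schema R_ImpR [(insert (unf \<phi>) \<Gamma>, {unf \<psi>})] (\<Gamma>, insert (unf (Imp \<phi> \<psi>)) \<Delta>)"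
| "schema R_U [(\<Gamma>, insert (unf \<phi>) \<Delta>)] (\<Gamma>, insert (foc \<phi>) \<Delta>)"
| "schema R_F [(\<Gamma>, insert (foc \<phi>) \<Delta>)] (\<Gamma>, insert (unf \<phi>) \<Delta>)"
| "schema R_K [(\<Gamma>, {(\<phi>, x)})] (\<Pi> \<union> Know_set a \<Gamma>, insert (Know a \<phi>, x) \<Sigma>)"
| "schema R_T [(insert (unf \<phi>) \<Gamma>, \<Delta>)] (insert (unf (Know a \<phi>)) \<Gamma>, \<Delta>)"
| "schema R_S4 [(Know_set a \<Gamma>, {(\<phi>, x)})] (\<Pi> \<union> Know_set a \<Gamma>, insert (Know a \<phi>, x) \<Sigma>)"
| "schema R_CL [(insert (unf \<phi>) (\<Gamma> \<union> range (\<lambda>a. unf (Know a (Common \<phi>)))), \<Delta>)]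
    (insert (unf (Common \<phi>)) \<Gamma>, \<Delta>)"
| "distinct as \<Longrightarrow> set as = UNIV \<Longrightarrow>
    schema (R_CR x)
      ((\<Gamma>, insert (unf \<phi>) \<Delta>) # map (\<lambda>a. (\<Gamma>, insert (Know a (Common \<phi>), x) \<Delta>)) as)
      (\<Gamma>, insert (Common \<phi>, x) \<Delta>)"

definition rule_instance ::
  "rule \<Rightarrow> ('p, 'a::finite) sequent list \<Rightarrow> ('p, 'a) sequent \<Rightarrow> bool" where
  "rule_instance r \<rho>s \<sigma> \<longleftrightarrow> schema r \<rho>s \<sigma> \<and> (\<forall>\<rho>\<in>set \<rho>s. is_sequent \<rho>) \<and> is_sequent \<sigma>"

definition nICK :: "rule set" where
  "nICK = {Ax_Id, Ax_Bot, R_AndL, R_AndR, R_OrL, R_OrR, R_ImpL, R_ImpR, R_U, R_F, R_K, R_CL,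
     R_CR Unfocused, R_CR Focused}"

definition nICKT :: "rule set" where
  "nICKT = insert R_T nICK"

definition nICKS4 :: "rule set" where
  "nICKS4 = insert R_S4 (nICKT - {R_K})"

codatatype ('p, 'a) tree = Node (label: "('p, 'a) sequent") (children: "('p, 'a) tree list")

inductive_set nodes :: "('p, 'a) tree \<Rightarrow> ('p, 'a) tree set" for t where
  root: "t \<in> nodes t"
| child: "s \<in> nodes t \<Longrightarrow> s' \<in> set (children s) \<Longrightarrow> s' \<in> nodes t"

definition pre_proof :: "rule set \<Rightarrow> ('p, 'a::finite) sequent \<Rightarrow> ('p, 'a) tree \<Rightarrow> bool" where
  "pre_proof R \<sigma> t \<longleftrightarrow> label t = \<sigma> \<and>
     (\<forall>s\<in>nodes t. is_sequent (label s) \<and>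
        (children s \<noteq> [] \<longrightarrow> (\<exists>r\<in>R. rule_instance r (map label (children s)) (label s))))"

definition infinite_branch :: "('p, 'a) tree \<Rightarrow> (nat \<Rightarrow> ('p, 'a) tree) \<Rightarrow> bool" where
  "infinite_branch t b \<longleftrightarrow> b 0 = t \<and> (\<forall>n. b (Suc n) \<in> set (children (b n)))"

definition good_branch :: "(nat \<Rightarrow> ('p, 'a::finite) tree) \<Rightarrow> bool" where
  "good_branch b \<longleftrightarrow> (\<exists>N. (\<forall>n\<ge>N. has_focus (label (b n))) \<and>
     (\<exists>\<^sub>\<infinity>n. n \<ge> N \<and> rule_instance (R_CR Focused) (map label (children (b n))) (label (b n))))"

definition nwf_proof :: "rule set \<Rightarrow> ('p, 'a::finite) sequent \<Rightarrow> ('p, 'a) tree \<Rightarrow> bool" where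
  "nwf_proof R \<sigma> t \<longleftrightarrow> pre_proof R \<sigma> t \<and>
     (\<forall>s\<in>nodes t. children s = [] \<longrightarrow>
        rule_instance Ax_Id [] (label s) \<or> rule_instance Ax_Bot [] (label s)) \<and>
     (\<forall>b. infinite_branch t b \<longrightarrow> good_branch b)"

end

(* The countermodel of an unprovable sequent has as worlds the left-hand sides of the saturated
   unprovable unfocused sequents over a finite closed set of formulae, ordered by inclusion.
   Dropping the right-hand sides makes the order antisymmetric: every formula that occurs on some such
   right-hand side is false at the world. For the truth lemma, the only formulae on the right that
   need more than a single rule are those of the form C phi. If C phi were true at the
   world Gamma of an unprovable sequent Gamma => Delta with C phi in Delta, then unfolding C phi in
   focus, stepping through the modal rule and saturating leads, on every branch that is not already
   provable, to another world where C phi is true. Repeating this forever yields a non-wellfounded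
   proof of the sequent. *)

theory Submission imports Defs
begin

section \<open>Gluing non-wellfounded proofs\<close>

text \<open>The calculi have no cut, so the set of worlds where \<open>Common \<phi>\<close> holds
  cannot be described by a formula and used as an invariant. Truth in the model takes over that
  role: the assumption that \<open>Common \<phi>\<close> is true where it should be refuted is
  itself the invariant that keeps the proof construction going, and the proof obtained contradicts
  unprovability. The first premise of each focused \<open>R_CR\<close> step costs nothing: if it
  were unprovable, the induction hypothesis would make \<open>\<phi>\<close> false at a larger
  world, against persistence. In the other premises the modal rule discards the right-hand context
  but carries the focus along, and saturation uses rules that leave the focused formula in place.
  The remaining obstacle is global. The pieces between two visits to a world are finite but of
  varying height, and some of their leaves are proofs obtained independently. Gluing them into one
  tree whose branches are all good is therefore isolated in a coinduction principle that knows
  nothing about models.\<close>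

definition provable :: "rule set \<Rightarrow> ('p, 'a::finite) sequent \<Rightarrow> bool" where
  "provable R \<sigma> \<longleftrightarrow> (\<exists>t. nwf_proof R \<sigma> t)"

lemma schema_no_premises: "schema r [] \<sigma> \<Longrightarrow> r = Ax_Id \<or> r = Ax_Bot"
  by (erule schema.cases) auto

lemma provable_is_sequent: "provable R \<sigma> \<Longrightarrow> is_sequent \<sigma>"
  unfolding provable_def nwf_proof_def pre_proof_def using nodes.root by blast

lemma nodes_trans: "s \<in> nodes t \<Longrightarrow> t \<in> nodes u \<Longrightarrow> s \<in> nodes u"
  by (induction rule: nodes.induct) (auto intro: nodes.child)

lemma nodes_unfold: "nodes t = insert t (\<Union>s\<in>set (children t). nodes s)"
proof
  show "nodes t \<subseteq> insert t (\<Union>s\<in>set (children t). nodes s)"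
  proof
    fix x assume "x \<in> nodes t"
    then show "x \<in> insert t (\<Union>s\<in>set (children t). nodes s)"
      by (induction rule: nodes.induct) (auto intro: nodes.intros)
  qed
  show "insert t (\<Union>s\<in>set (children t). nodes s) \<subseteq> nodes t"
    by (auto intro: nodes.root nodes_trans[OF _ nodes.child[OF nodes.root]])
qed

text \<open>Goodness is a tail property, so a branch may be judged from the point where it enters a
  subtree already known to be a proof.\<close>

lemma good_branch_suffix:
  assumes "good_branch (\<lambda>n. b (n + k))"
  shows "good_branch b"
proof -
  obtain N where N: "\<forall>n\<ge>N. has_focus (label (b (n + k)))"
    and inf: "\<exists>\<^sub>\<infinity>n. n \<ge> N \<and>
      rule_instance (R_CR Focused) (map label (children (b (n + k)))) (label (b (n + k)))"
    using assms unfolding good_branch_def by auto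
  have "\<forall>n\<ge>N + k. has_focus (label (b n))"
  proof (intro allI impI)
    fix n assume "n \<ge> N + k"
    then show "has_focus (label (b n))" using N[rule_format, of "n - k"] by simp
  qed
  moreover have "\<exists>\<^sub>\<infinity>n. n \<ge> N + k \<and>
      rule_instance (R_CR Focused) (map label (children (b n))) (label (b n))"
    unfolding INFM_nat
  proof
    fix m
    obtain n where "n > m" "n \<ge> N"
      "rule_instance (R_CR Focused) (map label (children (b (n + k)))) (label (b (n + k)))"
      using inf unfolding INFM_nat by blast
    then show "\<exists>n>m. n \<ge> N + k \<and>
        rule_instance (R_CR Focused) (map label (children (b n))) (label (b n))"
      by (intro exI[of _ "n + k"]) auto
  qed
  ultimately show ?thesis unfolding good_branch_def by blast
qed

lemma nwf_proof_child:
  assumes "nwf_proof R \<sigma> t" and "s \<in> set (children t)"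
  shows "nwf_proof R (label s) s"
proof -
  have sub: "nodes s \<subseteq> nodes t" using assms(2) nodes_unfold[of t] by blast
  have "good_branch b" if "infinite_branch s b" for b
  proof -
    have "infinite_branch t (case_nat t b)"
      using that assms(2) unfolding infinite_branch_def by (auto split: nat.split)
    then have "good_branch (case_nat t b)" using assms(1) unfolding nwf_proof_def by blast
    then obtain N where N: "\<forall>n\<ge>N. has_focus (label (case_nat t b n))"
      and inf: "\<exists>\<^sub>\<infinity>n. n \<ge> N \<and> rule_instance (R_CR Focused)
        (map label (children (case_nat t b n))) (label (case_nat t b n))"
      unfolding good_branch_def by auto
    have "\<forall>n\<ge>N. has_focus (label (b n))"
      using N by (metis le_SucI old.nat.simps(5))
    moreover have "\<exists>\<^sub>\<infinity>n. n \<ge> N \<and>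
        rule_instance (R_CR Focused) (map label (children (b n))) (label (b n))"
      unfolding INFM_nat
    proof
      fix m
      \<comment> \<open>Position \<open>n\<close> of the prolonged branch is position
        \<open>n - 1\<close> of \<open>b\<close>; the bound keeps \<open>n - 1\<close> above both
        \<open>m\<close> and \<open>N\<close>.\<close>
      obtain n where n: "n > Suc (m + N)" "rule_instance (R_CR Focused)
          (map label (children (case_nat t b n))) (label (case_nat t b n))"
        using inf unfolding INFM_nat by blast
      then show "\<exists>n>m. n \<ge> N \<and>
          rule_instance (R_CR Focused) (map label (children (b n))) (label (b n))"
        by (cases n) (auto intro!: exI[of _ "n - 1"])
    qed
    ultimately show ?thesis unfolding good_branch_def by blast
  qed
  then show ?thesis using assms(1) sub unfolding nwf_proof_def pre_proof_def by blast
qed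

lemma nwf_proofI:
  assumes "is_sequent (label t)"
    and "r \<in> R" "rule_instance r (map label (children t)) (label t)"
    and "\<forall>s\<in>set (children t). nwf_proof R (label s) s"
  shows "nwf_proof R (label t) t"
  unfolding nwf_proof_def pre_proof_def
proof (intro conjI ballI impI allI refl)
  have leaf: "rule_instance Ax_Id [] (label t) \<or> rule_instance Ax_Bot [] (label t)"
    if "children t = []"
    using assms(3) that schema_no_premises[of r "label t"] unfolding rule_instance_def by auto
  fix s assume s: "s \<in> nodes t"
  then have "s = t \<or> (\<exists>u\<in>set (children t). s \<in> nodes u)" using nodes_unfold[of t] by blast
  then show "is_sequent (label s)"
      "children s \<noteq> [] \<Longrightarrow> \<exists>r\<in>R. rule_instance r (map label (children s)) (label s)"
      "children s = [] \<Longrightarrow> rule_instance Ax_Id [] (label s) \<or> rule_instance Ax_Bot [] (label s)"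
    using assms leaf unfolding nwf_proof_def pre_proof_def by blast+
next
  fix b assume b: "infinite_branch t b"
  then have "b 1 \<in> set (children t)" unfolding infinite_branch_def by (metis One_nat_def)
  moreover have "infinite_branch (b 1) (\<lambda>n. b (n + 1))"
    using b unfolding infinite_branch_def by simp
  ultimately show "good_branch b"
    using assms(4) good_branch_suffix[of b 1] unfolding nwf_proof_def by blast
qed

lemma provable_rule:
  assumes "r \<in> R" "rule_instance r \<rho>s \<sigma>" "\<forall>\<rho>\<in>set \<rho>s. provable R \<rho>"
  shows "provable R \<sigma>"
proof -
  have "\<forall>\<rho>\<in>set \<rho>s. \<exists>t. nwf_proof R \<rho> t" using assms(3) unfolding provable_def .
  from bchoice[OF this] obtain pf where pf: "\<forall>\<rho>\<in>set \<rho>s. nwf_proof R \<rho> (pf \<rho>)" by blast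
  then have lab: "label (pf \<rho>) = \<rho>" if "\<rho> \<in> set \<rho>s" for \<rho>
    using that unfolding nwf_proof_def pre_proof_def by blast
  have "map label (children (Node \<sigma> (map pf \<rho>s))) = \<rho>s"
    using lab by (simp add: map_idI)
  then have "nwf_proof R (label (Node \<sigma> (map pf \<rho>s))) (Node \<sigma> (map pf \<rho>s))"
    using assms(1,2) pf lab by (intro nwf_proofI) (auto simp: rule_instance_def)
  then show ?thesis unfolding provable_def by auto
qed

section \<open>Coinduction along focused derivations\<close>

text \<open>These are the finite pieces of the infinite proof: every inner sequent carries a focus,
  and a leaf is either provable outright or a return to \<open>F\<close>. The index is an upper
  bound for the height, not the height itself, so that premises of different heights can share one
  index.\<close>

inductive focused_derivable ::
  "rule set \<Rightarrow> ('p, 'a::finite) sequent set \<Rightarrow> nat \<Rightarrow> ('p, 'a) sequent \<Rightarrow> bool" for R F where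
  proved: "provable R \<sigma> \<Longrightarrow> focused_derivable R F n \<sigma>"
| open_leaf: "\<sigma> \<in> F \<Longrightarrow> focused_derivable R F n \<sigma>"
| step: "r \<in> R \<Longrightarrow> rule_instance r \<rho>s \<sigma> \<Longrightarrow> has_focus \<sigma> \<Longrightarrow>
    (\<And>\<rho>. \<rho> \<in> set \<rho>s \<Longrightarrow> focused_derivable R F n \<rho>) \<Longrightarrow> focused_derivable R F (Suc n) \<sigma>"

lemma focused_derivable_mono:
  "focused_derivable R F n \<sigma> \<Longrightarrow> n \<le> m \<Longrightarrow> focused_derivable R F m \<sigma>"
proof (induction n \<sigma> arbitrary: m rule: focused_derivable.induct)
  case (step r \<rho>s \<sigma> n)
  then obtain k where "m = Suc k" "n \<le> k" by (cases m) auto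
  then show ?case using step by (auto intro!: focused_derivable.step[of r])
qed (auto intro: focused_derivable.intros)

text \<open>Closure under rules with a focused conclusion is what allows focused derivability to
  replace provability in the saturation argument.\<close>

lemma focused_derivable_rule:
  assumes "r \<in> R" "rule_instance r \<rho>s \<sigma>" "has_focus \<sigma>"
    and "\<forall>\<rho>\<in>set \<rho>s. \<exists>n. focused_derivable R F n \<rho>"
  shows "\<exists>n. focused_derivable R F n \<sigma>"
proof -
  from bchoice[OF assms(4)] obtain N where
    N: "\<forall>\<rho>\<in>set \<rho>s. focused_derivable R F (N \<rho>) \<rho>" ..
  \<comment> \<open>Without premises this is an unspecified maximum of the empty set, but then the
    claim is vacuous.\<close>
  have "focused_derivable R F (Max (N ` set \<rho>s)) \<rho>" if "\<rho> \<in> set \<rho>s" for \<rho>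
    by (rule focused_derivable_mono[OF N[rule_format, OF that]]) (simp add: that)
  then have "focused_derivable R F (Suc (Max (N ` set \<rho>s))) \<sigma>"
    by (rule focused_derivable.step[OF assms(1-3)])
  then show ?thesis ..
qed

primcorec unfold_tree ::
  "('s \<Rightarrow> ('p, 'a) sequent) \<Rightarrow> ('s \<Rightarrow> 's list) \<Rightarrow> 's \<Rightarrow> ('p, 'a) tree" where
  "unfold_tree l f s = Node (l s) (map (unfold_tree l f) (f s))"

text \<open>The hypotheses say that \<open>h\<close> is a coalgebra morphism from trees to states.
  Followed by the unfolding it is an endomorphism of the final coalgebra, hence the identity. With
  \<open>h = Inl\<close> this grafts finished proofs unchanged.\<close>

lemma unfold_tree_id:
  assumes "\<And>t. l (h t) = label t" "\<And>t. f (h t) = map h (children t)"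
  shows "unfold_tree l f (h t) = t"
proof (coinduction arbitrary: t)
  case Eq_tree
  show ?case using assms by (auto simp: list_all2_conv_all_nth)
qed

text \<open>Coinduction with guard: a branch that visits \<open>F\<close> infinitely often applies the focused
  \<open>R_CR\<close> rule infinitely often, and the index of \<open>focused_derivable\<close> bounds the way to the
  next visit.\<close>

lemma provable_coinduct:
  fixes \<sigma>\<^sub>0 :: "('p, 'a::finite) sequent"
  assumes CR: "R_CR Focused \<in> R"
    and F: "\<And>\<sigma>. \<sigma> \<in> F \<Longrightarrow> has_focus \<sigma> \<and> (\<exists>\<rho>s. rule_instance (R_CR Focused) \<rho>s \<sigma> \<and>
      (\<forall>\<rho>\<in>set \<rho>s. \<exists>n. focused_derivable R F n \<rho>))"
    and "\<sigma>\<^sub>0 \<in> F"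
  shows "provable R \<sigma>\<^sub>0"
proof (rule ccontr)
  assume "\<not> provable R \<sigma>\<^sub>0"
  \<comment> \<open>A provable sequent receives a finished proof instead of being expanded, so only
    members of \<open>D\<close> are ever expanded.\<close>
  define D where "D = {\<sigma>. \<not> provable R \<sigma> \<and> (\<exists>n. focused_derivable R F n \<sigma>)}"
  define rank where "rank \<sigma> = (LEAST n. focused_derivable R F n \<sigma>)" for \<sigma>
  have "\<sigma>\<^sub>0 \<in> D"
    using \<open>\<not> provable R \<sigma>\<^sub>0\<close> \<open>\<sigma>\<^sub>0 \<in> F\<close> unfolding D_def by (auto intro: open_leaf)
  \<comment> \<open>An expansion is either a focused \<open>R_CR\<close> step, after which the rank
    may rise again, or it lowers the rank of every unprovable premise.\<close>
  let ?ok = "\<lambda>\<sigma> \<rho>s. (\<exists>r\<in>R. rule_instance r \<rho>s \<sigma>) \<and> has_focus \<sigma> \<and>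
    (\<forall>\<rho>\<in>set \<rho>s. provable R \<rho> \<or> \<rho> \<in> D) \<and>
    (rule_instance (R_CR Focused) \<rho>s \<sigma> \<or> (\<forall>\<rho>\<in>set \<rho>s. provable R \<rho> \<or> rank \<rho> < rank \<sigma>))"
  have "\<exists>\<rho>s. ?ok \<sigma> \<rho>s" if "\<sigma> \<in> D" for \<sigma>
  proof (cases "\<sigma> \<in> F")
    case True
    then obtain \<rho>s where "has_focus \<sigma>" "rule_instance (R_CR Focused) \<rho>s \<sigma>"
      "\<forall>\<rho>\<in>set \<rho>s. \<exists>n. focused_derivable R F n \<rho>" using F by blast
    then show ?thesis using CR unfolding D_def by blast
  next
    case False
    have "focused_derivable R F (rank \<sigma>) \<sigma>"
      using that LeastI_ex[of "\<lambda>n. focused_derivable R F n \<sigma>"] unfolding D_def rank_def by simp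
    then show ?thesis
    proof cases
      case (step r \<rho>s n)
      have "rank \<rho> < rank \<sigma>" if "\<rho> \<in> set \<rho>s" for \<rho>
      proof -
        have "rank \<rho> \<le> n" unfolding rank_def using step that by (blast intro: Least_le)
        then show ?thesis using step(1) by simp
      qed
      then show ?thesis using step unfolding D_def by blast
    qed (use that False in \<open>auto simp: D_def\<close>)
  qed
  then have "\<forall>\<sigma>\<in>D. \<exists>\<rho>s. ?ok \<sigma> \<rho>s" by blast
  from bchoice[OF this] obtain nxt where nxt: "\<And>\<sigma>. \<sigma> \<in> D \<Longrightarrow> ?ok \<sigma> (nxt \<sigma>)" by blast
  then have nxt_rule: "\<exists>r\<in>R. rule_instance r (nxt \<sigma>) \<sigma>" and nxt_focus: "has_focus \<sigma>"
    and nxt_premises: "\<And>\<rho>. \<rho> \<in> set (nxt \<sigma>) \<Longrightarrow> provable R \<rho> \<or> \<rho> \<in> D"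
    and nxt_rank: "rule_instance (R_CR Focused) (nxt \<sigma>) \<sigma> \<or>
      (\<forall>\<rho>\<in>set (nxt \<sigma>). provable R \<rho> \<or> rank \<rho> < rank \<sigma>)"
    if "\<sigma> \<in> D" for \<sigma> using that by blast+
  define pf where "pf \<rho> = (SOME t. nwf_proof R \<rho> t)" for \<rho> :: "('p, 'a) sequent"
  have pf: "nwf_proof R \<rho> (pf \<rho>)" if "provable R \<rho>" for \<rho>
    using that unfolding pf_def provable_def by (rule someI_ex)
  have lab_nwf: "label t = \<rho>" if "nwf_proof R \<rho> t" for \<rho> and t :: "('p, 'a) tree"
    using that unfolding nwf_proof_def pre_proof_def by blast
  define st where "st \<rho> = (if provable R \<rho> then Inl (pf \<rho>) else Inr \<rho>)" for \<rho>
  define l where "l = case_sum label (\<lambda>\<sigma> :: ('p, 'a) sequent. \<sigma>)"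
  define f where "f = case_sum (\<lambda>t. map Inl (children t)) (\<lambda>\<sigma>. map st (nxt \<sigma>))"
  define T where "T = unfold_tree l f"
  have T_Inl: "T (Inl t) = t" for t
    unfolding T_def by (rule unfold_tree_id) (simp_all add: l_def f_def)
  have label_T: "label (T (Inr \<sigma>)) = \<sigma>" for \<sigma> by (simp add: T_def l_def)
  have children_T: "children (T (Inr \<sigma>)) = map (T \<circ> st) (nxt \<sigma>)" for \<sigma>
    by (simp add: T_def f_def)
  have label_st: "label (T (st \<rho>)) = \<rho>" for \<rho>
    using lab_nwf pf label_T T_Inl unfolding st_def by auto
  have labels: "map label (children (T (Inr \<sigma>))) = nxt \<sigma>" for \<sigma>
    by (simp add: children_T label_st map_idI)
  \<comment> \<open>An expanded node can be recognised from its label alone, as the unfolding of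
    that label; the claims about nodes need not mention states.\<close>
  let ?new = "\<lambda>s. s = T (Inr (label s)) \<and> label s \<in> D"
  have new_child: "nwf_proof R (label s) s \<or> ?new s \<and> label s \<in> set (nxt \<sigma>) \<and> \<not> provable R (label s)"
    if s: "\<sigma> \<in> D" "s \<in> set (children (T (Inr \<sigma>)))" for s \<sigma>
  proof -
    obtain \<rho> where \<rho>: "\<rho> \<in> set (nxt \<sigma>)" "s = T (st \<rho>)" using s(2) by (auto simp: children_T)
    show ?thesis
    proof (cases "provable R \<rho>")
      case True
      then have "s = pf \<rho>" using \<rho>(2) T_Inl by (simp add: st_def)
      then show ?thesis using pf[OF True] lab_nwf by metis
    next
      case False
      then have "s = T (Inr \<rho>)" "label s = \<rho>" using \<rho>(2) label_T by (simp_all add: st_def)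
      moreover have "\<rho> \<in> D" using False \<rho>(1) nxt_premises[OF s(1)] by blast
      ultimately show ?thesis using False \<rho>(1) by simp
    qed
  qed
  have new_node: "is_sequent (label s) \<and>
      (\<exists>r\<in>R. rule_instance r (map label (children s)) (label s))" if s: "?new s" for s
  proof -
    obtain r where "r \<in> R" "rule_instance r (nxt (label s)) (label s)"
      using nxt_rule s by blast
    moreover have "map label (children s) = nxt (label s)" using s labels by metis
    ultimately show ?thesis unfolding rule_instance_def by auto
  qed
  have nodes: "nwf_proof R (label s) s \<or> ?new s" if "s \<in> nodes (T (Inr \<sigma>\<^sub>0))" for s
    using that
  proof (induction rule: nodes.induct)
    case root
    then show ?case using \<open>\<sigma>\<^sub>0 \<in> D\<close> label_T by auto
  next
    case (child s s')
    then show ?case using nwf_proof_child new_child by metis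
  qed
  have "good_branch b" if b: "infinite_branch (T (Inr \<sigma>\<^sub>0)) b" for b
  proof (cases "\<exists>k. nwf_proof R (label (b k)) (b k)")
    case True
    then obtain k where "nwf_proof R (label (b k)) (b k)" by blast
    moreover have "infinite_branch (b k) (\<lambda>n. b (n + k))"
      using b unfolding infinite_branch_def by simp
    ultimately have "good_branch (\<lambda>n. b (n + k))" unfolding nwf_proof_def by blast
    then show ?thesis by (rule good_branch_suffix)
  next
    case False
    have new: "?new (b n)" for n
    proof (induction n)
      case 0
      then show ?case using b \<open>\<sigma>\<^sub>0 \<in> D\<close> label_T unfolding infinite_branch_def by auto
    next
      case (Suc n)
      then have "b (Suc n) \<in> set (children (T (Inr (label (b n)))))"
        using b unfolding infinite_branch_def by metis
      then show ?case using new_child[of "label (b n)" "b (Suc n)"] Suc False by blast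
    qed
    have succ: "label (b (Suc n)) \<in> set (nxt (label (b n)))" "\<not> provable R (label (b n))" for n
    proof -
      have "b (Suc n) \<in> set (children (T (Inr (label (b n)))))"
        using b new unfolding infinite_branch_def by metis
      then show "label (b (Suc n)) \<in> set (nxt (label (b n)))"
        using new_child[of "label (b n)" "b (Suc n)"] new False by blast
      show "\<not> provable R (label (b n))" using new unfolding D_def by blast
    qed
    have foc: "has_focus (label (b n))" for n using nxt_focus new by blast
    have "\<exists>\<^sub>\<infinity>n. rule_instance (R_CR Focused) (map label (children (b n))) (label (b n))"
    proof (rule ccontr)
      assume "\<not> ?thesis"
      then obtain m where
        m: "\<And>n. n > m \<Longrightarrow> \<not> rule_instance (R_CR Focused) (map label (children (b n))) (label (b n))"
        unfolding INFM_nat by blast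
      have "rank (label (b (Suc n))) < rank (label (b n))" if "n > m" for n
      proof -
        have "\<not> rule_instance (R_CR Focused) (nxt (label (b n))) (label (b n))"
          using m[OF that] labels[of "label (b n)"] new[of n] by metis
        then show ?thesis using nxt_rank[of "label (b n)"] new[of n] succ(1)[of n] succ(2)[of "Suc n"] by blast
      qed
      \<comment> \<open>The descent is known only at positions beyond \<open>m\<close>, hence the
        shift by \<open>Suc m\<close>.\<close>
      then have "\<forall>n. ((rank \<circ> label \<circ> b) (Suc (Suc (m + n))), (rank \<circ> label \<circ> b) (Suc (m + n))) \<in> less_than"
        by simp
      then have "\<exists>g. \<forall>n. (g (Suc n), g n) \<in> less_than"
        by (intro exI[of _ "\<lambda>n. (rank \<circ> label \<circ> b) (Suc (m + n))"]) simp
      then show False using wf_less_than unfolding wf_iff_no_infinite_down_chain by blast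
    qed
    then show ?thesis using foc unfolding good_branch_def by (intro exI[of _ 0]) auto
  qed
  note good = this
  have "nwf_proof R \<sigma>\<^sub>0 (T (Inr \<sigma>\<^sub>0))"
    unfolding nwf_proof_def pre_proof_def
  proof (intro conjI ballI impI allI)
    show "label (T (Inr \<sigma>\<^sub>0)) = \<sigma>\<^sub>0" by (rule label_T)
    fix s assume "s \<in> nodes (T (Inr \<sigma>\<^sub>0))"
    note s = nodes[OF this]
    then show "is_sequent (label s)"
      using new_node nodes.root unfolding nwf_proof_def pre_proof_def by blast
    show "\<exists>r\<in>R. rule_instance r (map label (children s)) (label s)" if "children s \<noteq> []"
      using s that new_node nodes.root unfolding nwf_proof_def pre_proof_def by blast
    show "rule_instance Ax_Id [] (label s) \<or> rule_instance Ax_Bot [] (label s)"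
      if "children s = []"
      using s
    proof
      assume "nwf_proof R (label s) s"
      then show ?thesis using that nodes.root unfolding nwf_proof_def by blast
    next
      assume "?new s"
      from new_node[OF this] obtain r where "rule_instance r (map label (children s)) (label s)"
        by blast
      then have "rule_instance r [] (label s)" unfolding that by simp
      then show ?thesis using schema_no_premises unfolding rule_instance_def by blast
    qed
  qed (rule good)
  then show False using \<open>\<not> provable R \<sigma>\<^sub>0\<close> unfolding provable_def by blast
qed


section \<open>Saturation\<close>

text \<open>The Fischer-Ladner closure: apart from subformulae it contains the unfoldings
  \<open>Know a (Common \<phi>)\<close> that \<open>R_CL\<close> and \<open>R_CR\<close> create.
  Their only immediate subformula is \<open>Common \<phi>\<close> again, which keeps the set
  finite.\<close>

primrec closure :: "('p, 'a) fm \<Rightarrow> ('p, 'a) fm set" where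
  "closure Bot = {Bot}"
| "closure (Atom p) = {Atom p}"
| "closure (And \<phi> \<psi>) = insert (And \<phi> \<psi>) (closure \<phi> \<union> closure \<psi>)"
| "closure (Or \<phi> \<psi>) = insert (Or \<phi> \<psi>) (closure \<phi> \<union> closure \<psi>)"
| "closure (Imp \<phi> \<psi>) = insert (Imp \<phi> \<psi>) (closure \<phi> \<union> closure \<psi>)"
| "closure (Know a \<phi>) = insert (Know a \<phi>) (closure \<phi>)"
| "closure (Common \<phi>) = insert (Common \<phi>) (closure \<phi> \<union> range (\<lambda>a. Know a (Common \<phi>)))"

definition closed :: "('p, 'a) fm set \<Rightarrow> bool" where
  "closed S \<longleftrightarrow> (\<forall>\<phi>\<in>S. closure \<phi> \<subseteq> S)"

lemma self_in_closure: "\<phi> \<in> closure \<phi>"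
  by (cases \<phi>) auto

lemma finite_closure: "finite (closure (\<phi> :: ('p, 'a::finite) fm))"
  by (induction \<phi>) auto

lemma closure_trans: "\<psi> \<in> closure \<phi> \<Longrightarrow> closure \<psi> \<subseteq> closure \<phi>"
  by (induction \<phi>) auto

lemma closed_UN_closure: "closed (\<Union>\<phi>\<in>A. closure \<phi>)"
  unfolding closed_def using closure_trans by blast

lemma closedD:
  assumes "closed S"
  shows "And \<phi> \<psi> \<in> S \<Longrightarrow> \<phi> \<in> S \<and> \<psi> \<in> S" "Or \<phi> \<psi> \<in> S \<Longrightarrow> \<phi> \<in> S \<and> \<psi> \<in> S"
    "Imp \<phi> \<psi> \<in> S \<Longrightarrow> \<phi> \<in> S \<and> \<psi> \<in> S" "Know a \<phi> \<in> S \<Longrightarrow> \<phi> \<in> S"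
    "Common \<phi> \<in> S \<Longrightarrow> \<phi> \<in> S \<and> Know a (Common \<phi>) \<in> S"
  using assms self_in_closure[of \<phi>] self_in_closure[of \<psi>] unfolding closed_def by fastforce+

text \<open>\<open>Imp\<close> and \<open>Know\<close> on the right have no clause, since their
  rules discard the right-hand context and so lead to another world; \<open>Common\<close> on the
  right is left to the coinduction. The clause for \<open>Know\<close> depends on \<open>R\<close>,
  so that one notion serves all calculi.\<close>

definition saturated ::
  "rule set \<Rightarrow> ('p, 'a) fm set \<Rightarrow> ('p, 'a) fm set \<Rightarrow> bool" where
  "saturated R \<Gamma> \<Delta> \<longleftrightarrow> Bot \<notin> \<Gamma> \<and> \<Gamma> \<inter> \<Delta> = {} \<and>
     (\<forall>\<phi> \<psi>. And \<phi> \<psi> \<in> \<Gamma> \<longrightarrow> \<phi> \<in> \<Gamma> \<and> \<psi> \<in> \<Gamma>) \<and>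
     (\<forall>\<phi> \<psi>. And \<phi> \<psi> \<in> \<Delta> \<longrightarrow> \<phi> \<in> \<Delta> \<or> \<psi> \<in> \<Delta>) \<and>
     (\<forall>\<phi> \<psi>. Or \<phi> \<psi> \<in> \<Gamma> \<longrightarrow> \<phi> \<in> \<Gamma> \<or> \<psi> \<in> \<Gamma>) \<and>
     (\<forall>\<phi> \<psi>. Or \<phi> \<psi> \<in> \<Delta> \<longrightarrow> \<phi> \<in> \<Delta> \<and> \<psi> \<in> \<Delta>) \<and>
     (\<forall>\<phi> \<psi>. Imp \<phi> \<psi> \<in> \<Gamma> \<longrightarrow> \<phi> \<in> \<Delta> \<or> \<psi> \<in> \<Gamma>) \<and>
     (R_T \<in> R \<longrightarrow> (\<forall>a \<phi>. Know a \<phi> \<in> \<Gamma> \<longrightarrow> \<phi> \<in> \<Gamma>)) \<and>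
     (\<forall>\<phi>. Common \<phi> \<in> \<Gamma> \<longrightarrow> \<phi> \<in> \<Gamma> \<and> (\<forall>a. Know a (Common \<phi>) \<in> \<Gamma>))"

lemma saturatedD:
  assumes "saturated R \<Gamma> \<Delta>"
  shows "Bot \<notin> \<Gamma>" "\<phi> \<in> \<Gamma> \<Longrightarrow> \<phi> \<notin> \<Delta>"
    "And \<phi> \<psi> \<in> \<Gamma> \<Longrightarrow> \<phi> \<in> \<Gamma> \<and> \<psi> \<in> \<Gamma>" "And \<phi> \<psi> \<in> \<Delta> \<Longrightarrow> \<phi> \<in> \<Delta> \<or> \<psi> \<in> \<Delta>"
    "Or \<phi> \<psi> \<in> \<Gamma> \<Longrightarrow> \<phi> \<in> \<Gamma> \<or> \<psi> \<in> \<Gamma>" "Or \<phi> \<psi> \<in> \<Delta> \<Longrightarrow> \<phi> \<in> \<Delta> \<and> \<psi> \<in> \<Delta>"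
    "Imp \<phi> \<psi> \<in> \<Gamma> \<Longrightarrow> \<phi> \<in> \<Delta> \<or> \<psi> \<in> \<Gamma>"
    "R_T \<in> R \<Longrightarrow> Know a \<phi> \<in> \<Gamma> \<Longrightarrow> \<phi> \<in> \<Gamma>"
    "Common \<phi> \<in> \<Gamma> \<Longrightarrow> \<phi> \<in> \<Gamma> \<and> Know a (Common \<phi>) \<in> \<Gamma>"
  using assms unfolding saturated_def by blast+

text \<open>Only disjointness constrains \<open>Common\<close> on the right. This permits turning a
  focused \<open>Common \<phi>\<close> into an ordinary formula of a refuted sequent.\<close>

lemma saturated_insert_Common:
  "saturated R \<Gamma> \<Delta> \<Longrightarrow> Common \<phi> \<notin> \<Gamma> \<Longrightarrow> saturated R \<Gamma> (insert (Common \<phi>) \<Delta>)"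
  unfolding saturated_def by blast

lemma unf_in_image: "unf \<phi> \<in> unf ` \<Gamma> \<longleftrightarrow> \<phi> \<in> \<Gamma>"
  by auto

text \<open>Sets absorb principal formulae, so a pair that is maximal among those not in \<open>Q\<close> is saturated.\<close>

lemma saturation:
  fixes S :: "('p, 'a::finite) fm set"
  assumes S: "finite S" "closed S" and R: "nICK - {R_K} \<subseteq> R"
    and seq: "\<And>\<Gamma> \<Delta>. \<Gamma> \<subseteq> S \<Longrightarrow> \<Delta> \<subseteq> S \<Longrightarrow> is_sequent (unf ` \<Gamma>, unf ` \<Delta> \<union> \<Phi>)"
    and rule: "\<And>r \<rho>s \<Gamma> \<Delta>. r \<in> R \<Longrightarrow> rule_instance r \<rho>s (unf ` \<Gamma>, unf ` \<Delta> \<union> \<Phi>) \<Longrightarrow>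
      \<forall>\<rho>\<in>set \<rho>s. Q \<rho> \<Longrightarrow> Q (unf ` \<Gamma>, unf ` \<Delta> \<union> \<Phi>)"
    and start: "\<Gamma> \<subseteq> S" "\<Delta> \<subseteq> S" "\<not> Q (unf ` \<Gamma>, unf ` \<Delta> \<union> \<Phi>)"
  shows "\<exists>\<Gamma>' \<Delta>'. \<Gamma> \<subseteq> \<Gamma>' \<and> \<Gamma>' \<subseteq> S \<and> \<Delta> \<subseteq> \<Delta>' \<and> \<Delta>' \<subseteq> S \<and>
    \<not> Q (unf ` \<Gamma>', unf ` \<Delta>' \<union> \<Phi>) \<and> saturated R \<Gamma>' \<Delta>' \<and> \<Gamma>' \<inter> fst ` \<Phi> = {}"
proof -
  \<comment> \<open>\<open>\<Phi>\<close> is the part of the right-hand side that never changes: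
    empty when \<open>Q\<close> is provability, the focused formula when \<open>Q\<close> is focused
    derivability.\<close>
  define M where "M = {(G, D). \<Gamma> \<subseteq> G \<and> G \<subseteq> S \<and> \<Delta> \<subseteq> D \<and> D \<subseteq> S \<and> \<not> Q (unf ` G, unf ` D \<union> \<Phi>)}"
  have "M \<subseteq> Pow S \<times> Pow S" unfolding M_def by auto
  then have "finite M" using S(1) by (meson finite_Pow_iff finite_SigmaI finite_subset)
  have "(\<Gamma>, \<Delta>) \<in> M" using start unfolding M_def by auto
  then have "Max ((\<lambda>(G, D). card G + card D) ` M) \<in> (\<lambda>(G, D). card G + card D) ` M"
    using \<open>finite M\<close> by (intro Max_in) auto
  then obtain G D where GD: "(G, D) \<in> M"
    and "Max ((\<lambda>(G, D). card G + card D) ` M) = card G + card D" by auto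
  then have max: "card G' + card D' \<le> card G + card D" if "(G', D') \<in> M" for G' D'
    using that \<open>finite M\<close> by (metis (mono_tags, lifting) Max_ge case_prod_conv finite_imageI image_eqI)
  have sub: "\<Gamma> \<subseteq> G" "G \<subseteq> S" "\<Delta> \<subseteq> D" "D \<subseteq> S" and nQ: "\<not> Q (unf ` G, unf ` D \<union> \<Phi>)"
    using GD unfolding M_def by auto
  have grow: "Q (unf ` G', unf ` D' \<union> \<Phi>)"
    if "G \<subseteq> G'" "G' \<subseteq> S" "D \<subseteq> D'" "D' \<subseteq> S" "\<not> (G' = G \<and> D' = D)" for G' D'
  proof (rule ccontr)
    assume "\<not> ?thesis"
    then have "(G', D') \<in> M" using that sub unfolding M_def by auto
    then have *: "card G' + card D' \<le> card G + card D" by (rule max)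
    have fin: "finite G'" "finite D'" using that S(1) finite_subset by blast+
    then have "card G \<le> card G'" "card D \<le> card D'" using that card_mono by blast+
    then have "card G = card G'" "card D = card D'" using * by auto
    then show False using that fin card_subset_eq by metis
  qed
  \<comment> \<open>By maximality \<open>Q\<close> holds of every properly larger premise; if all
    premises were properly larger, \<open>Q\<close> would pass to the conclusion. So some premise is
    the pair itself, that is, its active formulae are already present. For an axiom, with
    \<open>ps\<close> empty, this is a contradiction.\<close>
  have inverse: "(G, D) \<in> set ps"
    if "r \<in> R"
      and sch: "schema r (map (\<lambda>(G', D'). (unf ` G', unf ` D' \<union> \<Phi>)) ps) (unf ` G, unf ` D \<union> \<Phi>)"
      and larger: "\<And>G' D'. (G', D') \<in> set ps \<Longrightarrow> G \<subseteq> G' \<and> G' \<subseteq> S \<and> D \<subseteq> D' \<and> D' \<subseteq> S" for r ps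
  proof (rule ccontr)
    assume no: "\<not> ?thesis"
    let ?\<rho>s = "map (\<lambda>(G', D'). (unf ` G', unf ` D' \<union> \<Phi>)) ps"
    have "is_sequent \<rho> \<and> Q \<rho>" if "\<rho> \<in> set ?\<rho>s" for \<rho>
    proof -
      obtain p where p: "p \<in> set ps" "\<rho> = (\<lambda>(G', D'). (unf ` G', unf ` D' \<union> \<Phi>)) p"
        using \<open>\<rho> \<in> set ?\<rho>s\<close> unfolding set_map by (rule imageE) (rule that)
      obtain G' D' where "p = (G', D')" by (cases p)
      then have *: "(G', D') \<in> set ps" "\<rho> = (unf ` G', unf ` D' \<union> \<Phi>)" using p by simp_all
      have sub': "G \<subseteq> G'" "G' \<subseteq> S" "D \<subseteq> D'" "D' \<subseteq> S" using larger[OF *(1)] by simp_all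
      moreover have "\<not> (G' = G \<and> D' = D)"
      proof
        assume "G' = G \<and> D' = D"
        then show False using *(1) no by simp
      qed
      ultimately have "Q \<rho>" unfolding *(2) by (rule grow)
      moreover have "is_sequent \<rho>" unfolding *(2) by (rule seq) (fact sub')+
      ultimately show ?thesis by simp
    qed
    moreover have "is_sequent (unf ` G, unf ` D \<union> \<Phi>)" by (rule seq) (fact sub)+
    ultimately have "rule_instance r ?\<rho>s (unf ` G, unf ` D \<union> \<Phi>)" and "\<forall>\<rho>\<in>set ?\<rho>s. Q \<rho>"
      using sch unfolding rule_instance_def by blast+
    then have "Q (unf ` G, unf ` D \<union> \<Phi>)" by (rule rule[OF \<open>r \<in> R\<close>])
    then show False using nQ by contradiction
  qed
  have R': "{Ax_Id, Ax_Bot, R_AndL, R_AndR, R_OrL, R_OrR, R_ImpL, R_CL} \<subseteq> R"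
    using R unfolding nICK_def by auto
  note absorb = insert_absorb unf_in_image
  \<comment> \<open>The identity axiom accepts any annotation on the right, so the left-hand side
    also avoids the formulae in \<open>\<Phi>\<close>.\<close>
  have id: "G \<inter> fst ` (unf ` D \<union> \<Phi>) = {}"
  proof (rule ccontr)
    assume "\<not> ?thesis"
    then obtain p where "fst p \<in> G" "p \<in> unf ` D \<union> \<Phi>" by blast
    moreover obtain \<phi> x where "p = (\<phi>, x)" by (cases p)
    ultimately have "\<phi> \<in> G" "(\<phi>, x) \<in> unf ` D \<union> \<Phi>" by simp_all
    then show False
      using inverse[of Ax_Id "[]"] schema.intros(1)[of \<phi> "unf ` G" x "unf ` D \<union> \<Phi>"] R'
      by (simp add: insert_absorb unf_in_image del: Un_iff)
  qed
  moreover have "fst ` (unf ` D \<union> \<Phi>) = D \<union> fst ` \<Phi>" by (simp add: image_Un image_image)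
  ultimately have disjoint: "G \<inter> D = {}" "G \<inter> fst ` \<Phi> = {}" by (simp_all add: Int_Un_distrib)
  have "saturated R G D"
    unfolding saturated_def
  proof (intro conjI allI impI)
    show "Bot \<notin> G"
    proof
      assume "Bot \<in> G"
      then show False
        using inverse[of Ax_Bot "[]"] schema.intros(2)[of "unf ` G" "unf ` D \<union> \<Phi>"] R'
        by (simp add: absorb)
    qed
    show "G \<inter> D = {}" by (fact disjoint)
    show "\<phi> \<in> G" "\<psi> \<in> G" if "And \<phi> \<psi> \<in> G" for \<phi> \<psi>
    proof -
      have "\<phi> \<in> S" "\<psi> \<in> S" using that sub closedD[OF S(2)] by blast+
      then show "\<phi> \<in> G" "\<psi> \<in> G"
        using inverse[of R_AndL "[(insert \<phi> (insert \<psi> G), D)]"]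
          schema.intros(3)[of \<phi> \<psi> "unf ` G" "unf ` D \<union> \<Phi>"] R' that sub
        by (auto simp: absorb)
    qed
    show "\<phi> \<in> D \<or> \<psi> \<in> D" if "And \<phi> \<psi> \<in> D" for \<phi> \<psi>
    proof -
      have "\<phi> \<in> S" "\<psi> \<in> S" using that sub closedD[OF S(2)] by blast+
      then show ?thesis
        using inverse[of R_AndR "[(G, insert \<phi> D), (G, insert \<psi> D)]"]
          schema.intros(4)[of "unf ` G" \<phi> "unf ` D \<union> \<Phi>" \<psi>] R' that sub
        by (auto simp: absorb)
    qed
    show "\<phi> \<in> G \<or> \<psi> \<in> G" if "Or \<phi> \<psi> \<in> G" for \<phi> \<psi>
    proof -
      have "\<phi> \<in> S" "\<psi> \<in> S" using that sub closedD[OF S(2)] by blast+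
      then show ?thesis
        using inverse[of R_OrL "[(insert \<phi> G, D), (insert \<psi> G, D)]"]
          schema.intros(5)[of \<phi> "unf ` G" "unf ` D \<union> \<Phi>" \<psi>] R' that sub
        by (auto simp: absorb)
    qed
    show "\<phi> \<in> D" "\<psi> \<in> D" if "Or \<phi> \<psi> \<in> D" for \<phi> \<psi>
    proof -
      have "\<phi> \<in> S" "\<psi> \<in> S" using that sub closedD[OF S(2)] by blast+
      then show "\<phi> \<in> D" "\<psi> \<in> D"
        using inverse[of R_OrR "[(G, insert \<phi> (insert \<psi> D))]"]
          schema.intros(6)[of "unf ` G" \<phi> \<psi> "unf ` D \<union> \<Phi>"] R' that sub
        by (auto simp: absorb)
    qed
    show "\<phi> \<in> D \<or> \<psi> \<in> G" if "Imp \<phi> \<psi> \<in> G" for \<phi> \<psi>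
    proof -
      have "\<phi> \<in> S" "\<psi> \<in> S" using that sub closedD[OF S(2)] by blast+
      then show ?thesis
        using inverse[of R_ImpL "[(G, insert \<phi> D), (insert \<psi> G, D)]"]
          schema.intros(7)[of "unf ` G" \<phi> "unf ` D \<union> \<Phi>" \<psi>] R' that sub
        by (auto simp: absorb)
    qed
    show "\<phi> \<in> G" if "R_T \<in> R" "Know a \<phi> \<in> G" for a \<phi>
    proof -
      have "\<phi> \<in> S" using that sub closedD[OF S(2)] by blast
      then show ?thesis
        using inverse[of R_T "[(insert \<phi> G, D)]"]
          schema.intros(12)[of \<phi> "unf ` G" "unf ` D \<union> \<Phi>" a] that sub
        by (auto simp: absorb)
    qed
    have *: "\<phi> \<in> G \<and> (\<forall>a. Know a (Common \<phi>) \<in> G)" if "Common \<phi> \<in> G" for \<phi>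
    proof -
      let ?G = "insert \<phi> (G \<union> range (\<lambda>b. Know b (Common \<phi>)))"
      have "unf ` ?G = insert (unf \<phi>) (unf ` G \<union> range (\<lambda>b. unf (Know b (Common \<phi>))))"
        by (auto simp: image_Un)
      moreover have "\<phi> \<in> S" "range (\<lambda>a. Know a (Common \<phi>)) \<subseteq> S"
        using that sub closedD[OF S(2)] by blast+
      ultimately have "?G = G"
        using inverse[of R_CL "[(?G, D)]"]
          schema.intros(14)[of \<phi> "unf ` G" "unf ` D \<union> \<Phi>"] R' that sub
        by (auto simp: absorb)
      then show ?thesis by blast
    qed
    show "\<phi> \<in> G" "Know a (Common \<phi>) \<in> G" if "Common \<phi> \<in> G" for \<phi> a
      using *[OF that] by blast+
  qed
  then show ?thesis
    by (intro exI[of _ G] exI[of _ D] conjI sub nQ disjoint(2))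
qed

section \<open>The canonical model\<close>

text \<open>\<open>core a \<Gamma>\<close> is what the modal rule for \<open>a\<close> keeps of the left-hand side \<open>\<Gamma>\<close>; it also determines
  the accessibility relation of the canonical model.\<close>

locale calculus =
  fixes R :: "rule set"
    and core :: "'a::finite \<Rightarrow> ('p, 'a) fm set \<Rightarrow> ('p, 'a) fm set"
    and S :: "('p, 'a) fm set"
  assumes rules: "nICK - {R_K} \<subseteq> R"
    and modal_rule: "\<exists>r\<in>R. schema r [(unf ` core a \<Gamma>, {(\<phi>, x)})] (unf ` \<Gamma>, insert (Know a \<phi>, x) \<Sigma>)"
    and core_mono: "\<Gamma> \<subseteq> \<Gamma>' \<Longrightarrow> core a \<Gamma> \<subseteq> core a \<Gamma>'"
    and core_subset: "core a \<Gamma> \<subseteq> \<Gamma> \<union> {\<psi>. Know a \<psi> \<in> \<Gamma>}"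
    and core_elim: "Know a \<psi> \<in> \<Gamma> \<Longrightarrow> core a \<Gamma> \<subseteq> \<Gamma>' \<Longrightarrow> saturated R \<Gamma>' \<Delta>' \<Longrightarrow> \<psi> \<in> \<Gamma>'"
    and finite_S: "finite S" and closed_S: "closed S"
begin

definition refuted :: "('p, 'a) fm set \<Rightarrow> ('p, 'a) fm set \<Rightarrow> bool" where
  "refuted \<Gamma> \<Delta> \<longleftrightarrow> \<Gamma> \<subseteq> S \<and> \<Delta> \<subseteq> S \<and> saturated R \<Gamma> \<Delta> \<and> \<not> provable R (unf ` \<Gamma>, unf ` \<Delta>)"

lemma finite_subset_S: "\<Gamma> \<subseteq> S \<Longrightarrow> finite \<Gamma>"
  using finite_S finite_subset by blast

lemma core_in_S: "\<Gamma> \<subseteq> S \<Longrightarrow> core a \<Gamma> \<subseteq> S"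
  using core_subset[of a \<Gamma>] closedD(4)[OF closed_S] by blast

lemma refuted_extension:
  assumes "\<Gamma> \<subseteq> S" "\<Delta> \<subseteq> S" "\<not> provable R (unf ` \<Gamma>, unf ` \<Delta>)"
  shows "\<exists>\<Gamma>' \<Delta>'. refuted \<Gamma>' \<Delta>' \<and> \<Gamma> \<subseteq> \<Gamma>' \<and> \<Delta> \<subseteq> \<Delta>'"
proof -
  have "\<exists>\<Gamma>' \<Delta>'. \<Gamma> \<subseteq> \<Gamma>' \<and> \<Gamma>' \<subseteq> S \<and> \<Delta> \<subseteq> \<Delta>' \<and> \<Delta>' \<subseteq> S \<and>
    \<not> provable R (unf ` \<Gamma>', unf ` \<Delta>' \<union> {}) \<and> saturated R \<Gamma>' \<Delta>' \<and>
    \<Gamma>' \<inter> fst ` ({} :: ('p, 'a) afm set) = {}"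
  proof (rule saturation[where Q = "provable R", OF finite_S closed_S rules])
    show "is_sequent (unf ` \<Gamma>, unf ` \<Delta> \<union> {})" if "\<Gamma> \<subseteq> S" "\<Delta> \<subseteq> S" for \<Gamma> \<Delta>
      using that finite_subset_S by auto
  qed (use assms in \<open>auto intro: provable_rule\<close>)
  then show ?thesis unfolding refuted_def by auto
qed

lemma modal_rule_instance:
  assumes "\<Gamma> \<subseteq> S" "finite \<Sigma>" "\<forall>\<psi>. foc \<psi> \<notin> \<Sigma>" "x = Focused \<longrightarrow> focusable \<phi> \<and> focusable (Know a \<phi>)"
  shows "\<exists>r\<in>R. rule_instance r [(unf ` core a \<Gamma>, {(\<phi>, x)})] (unf ` \<Gamma>, insert (Know a \<phi>, x) \<Sigma>)"
proof -
  obtain r where "r \<in> R" "schema r [(unf ` core a \<Gamma>, {(\<phi>, x)})] (unf ` \<Gamma>, insert (Know a \<phi>, x) \<Sigma>)"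
    using modal_rule by blast
  moreover have "finite \<Gamma>" "finite (core a \<Gamma>)"
    using assms(1) core_in_S finite_subset_S by auto
  ultimately show ?thesis
    using assms by (intro bexI[of _ r]) (auto simp: rule_instance_def)
qed

end

section \<open>Persistence and the truth lemma\<close>

text \<open>For \<open>Know\<close> and \<open>Common\<close>, triangle confluence lets the first
  accessibility step from the larger world start at the smaller one. Only the empty path under
  \<open>Common\<close> needs the induction hypothesis.\<close>

lemma sat_persistent:
  assumes "F \<in> epistemic_frames" "monotone_valuation F V"
  shows "(w, v) \<in> le F \<Longrightarrow> sat F V w \<phi> \<Longrightarrow> sat F V v \<phi>"
proof (induction \<phi> arbitrary: w v)
  case (Atom p)
  then show ?case using assms(2) unfolding monotone_valuation_def by auto
next
  case (Imp \<phi> \<psi>)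
  have "trans (le F)"
    using assms(1) unfolding epistemic_frames_def partial_order_on_def preorder_on_def by auto
  then show ?case using Imp.prems by (auto dest: transD)
next
  case (Know a \<phi>)
  then show ?case using assms(1) unfolding epistemic_frames_def by auto
next
  case (Common \<phi>)
  have "sat F V u \<phi>" if "(v, u) \<in> (\<Union>a. acc F a)\<^sup>*" for u
    using that
  proof (cases rule: converse_rtranclE)
    case base
    then show ?thesis using Common by auto
  next
    case (step y)
    then have "(w, y) \<in> (\<Union>a. acc F a)"
      using Common.prems(1) assms(1) unfolding epistemic_frames_def by blast
    then show ?thesis using step(2) Common.prems(2) by (auto intro: converse_rtrancl_into_rtrancl)
  qed
  then show ?case by simp
qed auto

text \<open>Worlds must come from the type over which validity is assumed, so left-hand sides are
  represented through \<open>th\<close>. Its injectivity makes inclusion antisymmetric on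
  \<open>W\<close>.\<close>

locale canonical_model = calculus R core S
  for R :: "rule set" and core :: "'a::finite \<Rightarrow> ('p, 'a) fm set \<Rightarrow> ('p, 'a) fm set" and S +
  fixes W :: "'w set" and th :: "'w \<Rightarrow> ('p, 'a) fm set"
  assumes th: "bij_betw th W {\<Gamma>. \<exists>\<Delta>. refuted \<Gamma> \<Delta>}" and nonempty: "W \<noteq> {}"
begin

definition canon :: "('w, 'a) frame" where
  "canon = \<lparr>worlds = W, le = {(x, y). x \<in> W \<and> y \<in> W \<and> th x \<subseteq> th y},
     acc = \<lambda>a. {(x, y). x \<in> W \<and> y \<in> W \<and> core a (th x) \<subseteq> th y}\<rparr>"

definition val :: "'w \<Rightarrow> 'p set" where
  "val x = {p. Atom p \<in> th x}"

lemma canon_simps [simp]: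
  "worlds canon = W"
  "(x, y) \<in> le canon \<longleftrightarrow> x \<in> W \<and> y \<in> W \<and> th x \<subseteq> th y"
  "(x, y) \<in> acc canon a \<longleftrightarrow> x \<in> W \<and> y \<in> W \<and> core a (th x) \<subseteq> th y"
  by (simp_all add: canon_def)

lemma th_surj: "refuted \<Gamma> \<Delta> \<Longrightarrow> \<exists>y\<in>W. th y = \<Gamma>"
  using th unfolding bij_betw_def by (metis (mono_tags, lifting) image_iff mem_Collect_eq)

lemma th_refuted: "x \<in> W \<Longrightarrow> \<exists>\<Delta>. refuted (th x) \<Delta>"
  using th unfolding bij_betw_def by blast

lemma canon_epistemic: "canon \<in> epistemic_frames"
proof -
  have "inj_on th W" using th unfolding bij_betw_def by blast
  then have "partial_order_on W (le canon)"
    unfolding partial_order_on_def preorder_on_def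
    by (auto simp: refl_on_def antisym_def inj_on_def canon_def intro!: transI)
  moreover have "(w, u) \<in> acc canon a" if "(w, v) \<in> le canon" "(v, u) \<in> acc canon a" for a w v u
    using that core_mono[of "th w" "th v" a] by (simp, blast)
  moreover have "acc canon a \<subseteq> W \<times> W" for a by auto
  ultimately show ?thesis
    using nonempty unfolding epistemic_frames_def by (simp del: canon_simps(2,3))
qed

lemma val_monotone: "monotone_valuation canon val"
  unfolding monotone_valuation_def val_def by auto

abbreviation csat :: "'w \<Rightarrow> ('p, 'a) fm \<Rightarrow> bool" where
  "csat \<equiv> sat canon val"

text \<open>If \<open>Common \<phi>\<close> were true at a world whose refutation contains it, then keeping \<open>Common \<phi>\<close> in
  focus and moving along the accessibility relations would never leave the worlds that satisfy it.
  The sequents met on the way form the set \<open>F\<close>, which is provable by coinduction.\<close>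

lemma Common_refuted:
  assumes IH: "\<And>x \<Delta>. x \<in> W \<Longrightarrow> refuted (th x) \<Delta> \<Longrightarrow> \<phi> \<in> \<Delta> \<Longrightarrow> \<not> csat x \<phi>"
    and x: "x \<in> W" "refuted (th x) \<Delta>" "Common \<phi> \<in> \<Delta>"
  shows "\<not> csat x (Common \<phi>)"
proof
  assume "csat x (Common \<phi>)"
  \<comment> \<open>The bound \<open>x\<close> and \<open>\<Delta>\<close> range over all worlds
    where the supposed failure recurs; the refuted \<open>Common \<phi>\<close> is moved into
    focus.\<close>
  define F where "F = {(unf ` th x, unf ` \<Delta> \<union> {foc (Common \<phi>)}) | x \<Delta>.
    x \<in> W \<and> refuted (th x) (insert (Common \<phi>) \<Delta>) \<and> csat x (Common \<phi>)}"
  let ?der = "\<lambda>\<sigma>. \<exists>n. focused_derivable R F n \<sigma>"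
  have seq: "is_sequent (unf ` \<Gamma>, unf ` \<Delta> \<union> {foc (Common \<phi>)})" if "\<Gamma> \<subseteq> S" "\<Delta> \<subseteq> S" for \<Gamma> \<Delta>
    using that finite_subset_S by (auto simp: focusable_def)
  have R: "R_U \<in> R" "R_F \<in> R" "R_CR Focused \<in> R" using rules unfolding nICK_def by auto
  have S: "\<phi> \<in> S" "Common \<phi> \<in> S"
    using x closedD(5)[OF closed_S, of \<phi>] unfolding refuted_def by blast+
  have CR: "has_focus \<sigma> \<and> (\<exists>\<rho>s. rule_instance (R_CR Focused) \<rho>s \<sigma> \<and> (\<forall>\<rho>\<in>set \<rho>s. ?der \<rho>))"
    if "\<sigma> \<in> F" for \<sigma>
  proof -
    from that obtain y \<Delta> where \<sigma>: "\<sigma> = (unf ` th y, insert (foc (Common \<phi>)) (unf ` \<Delta>))"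
      and y: "y \<in> W" "refuted (th y) (insert (Common \<phi>) \<Delta>)" "csat y (Common \<phi>)"
      unfolding F_def by auto
    have sub: "th y \<subseteq> S" "\<Delta> \<subseteq> S" using y(2) unfolding refuted_def by auto
    have fin: "finite (th y)" "finite \<Delta>" using sub finite_subset_S by auto
    \<comment> \<open>The first premise of \<open>R_CR\<close> leaves the focus for good: a
      refutation would give a larger world where \<open>\<phi>\<close> is false by
      \<open>IH\<close>, yet true by persistence.\<close>
    have "provable R (unf ` th y, unf ` insert \<phi> \<Delta>)"
    proof (rule ccontr)
      assume "\<not> ?thesis"
      then obtain \<Gamma>' \<Delta>' where ext: "refuted \<Gamma>' \<Delta>'" "th y \<subseteq> \<Gamma>'" "insert \<phi> \<Delta> \<subseteq> \<Delta>'"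
        using sub S refuted_extension[of "th y" "insert \<phi> \<Delta>"] by blast
      then obtain z where z: "z \<in> W" "th z = \<Gamma>'" using th_surj by blast
      have "csat y \<phi>" using y(3) by auto
      then have "csat z \<phi>"
        using sat_persistent[OF canon_epistemic val_monotone, of y z] y(1) z ext(2) by simp
      then show False using IH z ext by blast
    qed
    then have first: "?der (unf ` th y, insert (unf \<phi>) (unf ` \<Delta>))"
      by (auto intro: focused_derivable.proved)
    have others: "?der (unf ` th y, insert (foc (Know a (Common \<phi>))) (unf ` \<Delta>))" for a
    proof -
      have der: "?der (unf ` core a (th y), unf ` {} \<union> {foc (Common \<phi>)})"
      proof (rule ccontr)
        assume not_der: "\<not> ?thesis"
        have "\<exists>\<Gamma>' \<Delta>'. core a (th y) \<subseteq> \<Gamma>' \<and> \<Gamma>' \<subseteq> S \<and> {} \<subseteq> \<Delta>' \<and> \<Delta>' \<subseteq> S \<and>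
          \<not> ?der (unf ` \<Gamma>', unf ` \<Delta>' \<union> {foc (Common \<phi>)}) \<and> saturated R \<Gamma>' \<Delta>' \<and>
          \<Gamma>' \<inter> fst ` {foc (Common \<phi>)} = {}"
        \<comment> \<open>With the focused formula as \<open>\<Phi>\<close>, every conclusion
          considered has a focus, so \<open>?der\<close> is closed under all rules of
          \<open>R\<close>.\<close>
        proof (rule saturation[where Q = ?der, OF finite_S closed_S rules seq])
          show "?der (unf ` \<Gamma>, unf ` \<Delta> \<union> {foc (Common \<phi>)})"
            if "r \<in> R" "rule_instance r \<rho>s (unf ` \<Gamma>, unf ` \<Delta> \<union> {foc (Common \<phi>)})"
              "\<forall>\<rho>\<in>set \<rho>s. ?der \<rho>" for r \<rho>s \<Gamma> \<Delta>
            using that(1,2) _ that(3) by (rule focused_derivable_rule) (auto simp: has_focus_def)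
        qed (use core_in_S[OF sub(1)] not_der in simp_all)
        then obtain \<Gamma>' \<Delta>' where ext: "core a (th y) \<subseteq> \<Gamma>'" "\<Gamma>' \<subseteq> S" "\<Delta>' \<subseteq> S"
          "\<not> ?der (unf ` \<Gamma>', unf ` \<Delta>' \<union> {foc (Common \<phi>)})" "saturated R \<Gamma>' \<Delta>'"
          "\<Gamma>' \<inter> fst ` {foc (Common \<phi>)} = {}"
          by (elim exE conjE) (rule that)
        \<comment> \<open>By \<open>R_U\<close> a proof of the unfocused version would yield one of
          the focused version. Hence the saturated pair, with \<open>Common \<phi>\<close>
          unfocused, is refuted and determines a world.\<close>
        have "\<not> provable R (unf ` \<Gamma>', unf ` insert (Common \<phi>) \<Delta>')"
        proof
          assume *: "provable R (unf ` \<Gamma>', unf ` insert (Common \<phi>) \<Delta>')"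
          have "rule_instance R_U [(unf ` \<Gamma>', unf ` insert (Common \<phi>) \<Delta>')]
              (unf ` \<Gamma>', unf ` \<Delta>' \<union> {foc (Common \<phi>)})"
            using schema.intros(9)[of "unf ` \<Gamma>'" "Common \<phi>" "unf ` \<Delta>'"] seq[OF ext(2,3)]
              provable_is_sequent[OF *]
            unfolding rule_instance_def by (simp del: is_sequent.simps)
          then have "provable R (unf ` \<Gamma>', unf ` \<Delta>' \<union> {foc (Common \<phi>)})"
            by (rule provable_rule[OF R(1)]) (use * in simp)
          then show False using ext(4) focused_derivable.proved by metis
        qed
        then have ref: "refuted \<Gamma>' (insert (Common \<phi>) \<Delta>')"
          using ext(2,3,6) S(2) saturated_insert_Common[OF ext(5)] unfolding refuted_def by simp
        then obtain z where z: "z \<in> W" "th z = \<Gamma>'" using th_surj by blast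
        \<comment> \<open>The new world is accessible from \<open>y\<close>, so it inherits the
          truth of \<open>Common \<phi>\<close> and its sequent is again in
          \<open>F\<close>.\<close>
        then have yz: "(y, z) \<in> (\<Union>a. acc canon a)" using y(1) ext(1) by auto
        have "csat u \<phi>" if "(z, u) \<in> (\<Union>a. acc canon a)\<^sup>*" for u
          using converse_rtrancl_into_rtrancl[OF yz that] y(3) by simp
        then have "csat z (Common \<phi>)" by simp
        then have "(unf ` \<Gamma>', unf ` \<Delta>' \<union> {foc (Common \<phi>)}) \<in> F"
          using z ref unfolding F_def by blast
        then show False using ext(4) focused_derivable.open_leaf by metis
      qed
      let ?\<rho>s = "[(unf ` core a (th y), {foc (Common \<phi>)})]"
      have "\<exists>r\<in>R. rule_instance r ?\<rho>s (unf ` th y, insert (foc (Know a (Common \<phi>))) (unf ` \<Delta>))"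
        using sub fin by (intro modal_rule_instance) (auto simp: focusable_def)
      then obtain r where
        "r \<in> R" "rule_instance r ?\<rho>s (unf ` th y, insert (foc (Know a (Common \<phi>))) (unf ` \<Delta>))"
        by (rule bexE)
      moreover have "has_focus (unf ` th y, insert (foc (Know a (Common \<phi>))) (unf ` \<Delta>))"
        unfolding has_focus_def by auto
      moreover have "\<forall>\<rho>\<in>set ?\<rho>s. ?der \<rho>"
      proof
        fix \<rho> assume "\<rho> \<in> set ?\<rho>s"
        then have "\<rho> = (unf ` core a (th y), unf ` {} \<union> {foc (Common \<phi>)})" by simp
        then show "?der \<rho>" using der by simp
      qed
      ultimately show ?thesis by (rule focused_derivable_rule)
    qed
    obtain as :: "'a list" where as: "set as = UNIV" "distinct as"
      using finite_distinct_list[OF finite_UNIV] by blast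
    let ?\<rho>s = "(unf ` th y, insert (unf \<phi>) (unf ` \<Delta>)) #
      map (\<lambda>a. (unf ` th y, insert (foc (Know a (Common \<phi>))) (unf ` \<Delta>))) as"
    have "rule_instance (R_CR Focused) ?\<rho>s \<sigma>"
      using schema.intros(15)[OF as(2,1)] fin unfolding \<sigma> rule_instance_def
      by (auto simp: focusable_def)
    moreover have "\<forall>\<rho>\<in>set ?\<rho>s. ?der \<rho>" using first others by auto
    moreover have "has_focus \<sigma>" unfolding \<sigma> has_focus_def by auto
    ultimately show ?thesis by blast
  qed
  have "refuted (th x) (insert (Common \<phi>) \<Delta>)" using x by (simp add: insert_absorb)
  then have "(unf ` th x, unf ` \<Delta> \<union> {foc (Common \<phi>)}) \<in> F"
    unfolding F_def using x(1) \<open>csat x (Common \<phi>)\<close> by blast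
  then have *: "provable R (unf ` th x, insert (foc (Common \<phi>)) (unf ` \<Delta>))"
    using provable_coinduct[OF R(3) CR] by simp
  have is_seq: "is_sequent (unf ` th x, unf ` \<Delta>)"
    using x(2) finite_subset_S unfolding refuted_def by auto
  have "rule_instance R_F [(unf ` th x, insert (foc (Common \<phi>)) (unf ` \<Delta>))] (unf ` th x, unf ` \<Delta>)"
    using schema.intros(10)[of "unf ` th x" "Common \<phi>" "unf ` \<Delta>"] provable_is_sequent[OF *] x(3) is_seq
    unfolding rule_instance_def by (simp add: insert_absorb unf_in_image del: is_sequent.simps)
  then have "provable R (unf ` th x, unf ` \<Delta>)"
    by (rule provable_rule[OF R(2)]) (use * in simp)
  then show False using x(2) unfolding refuted_def by simp
qed

text \<open>Both halves are proved together because implication mixes them: on the left its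
  antecedent may end up in \<open>\<Delta>\<close>, on the right it enters the new world. The second
  half ranges over all \<open>\<Delta>\<close> since a world records only a left-hand side.\<close>

lemma truth:
  "x \<in> W \<Longrightarrow> (\<phi> \<in> th x \<longrightarrow> csat x \<phi>) \<and> (\<forall>\<Delta>. refuted (th x) \<Delta> \<longrightarrow> \<phi> \<in> \<Delta> \<longrightarrow> \<not> csat x \<phi>)"
proof (induction \<phi> arbitrary: x)
  case Bot
  then show ?case using th_refuted[of x] saturatedD(1) unfolding refuted_def by auto
next
  case (Atom p)
  have "p \<notin> val x" if "refuted (th x) \<Delta>" "Atom p \<in> \<Delta>" for \<Delta>
    using that saturatedD(2)[of R "th x" \<Delta> "Atom p"] unfolding refuted_def val_def by auto
  then show ?case by (auto simp: val_def)
next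
  case (And \<phi> \<psi>)
  obtain \<Delta>\<^sub>0 where sat: "saturated R (th x) \<Delta>\<^sub>0"
    using th_refuted[OF And.prems] unfolding refuted_def by blast
  have "csat x (And \<phi> \<psi>)" if "And \<phi> \<psi> \<in> th x"
    using saturatedD(3)[OF sat that] And.IH And.prems by simp
  moreover have "\<not> csat x (And \<phi> \<psi>)" if "refuted (th x) \<Delta>" "And \<phi> \<psi> \<in> \<Delta>" for \<Delta>
  proof -
    have "\<phi> \<in> \<Delta> \<or> \<psi> \<in> \<Delta>" using that saturatedD(4) unfolding refuted_def by blast
    then show ?thesis using that(1) And.IH And.prems by auto
  qed
  ultimately show ?case by blast
next
  case (Or \<phi> \<psi>)
  obtain \<Delta>\<^sub>0 where sat: "saturated R (th x) \<Delta>\<^sub>0"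
    using th_refuted[OF Or.prems] unfolding refuted_def by blast
  have "csat x (Or \<phi> \<psi>)" if "Or \<phi> \<psi> \<in> th x"
    using saturatedD(5)[OF sat that] Or.IH Or.prems by auto
  moreover have "\<not> csat x (Or \<phi> \<psi>)" if "refuted (th x) \<Delta>" "Or \<phi> \<psi> \<in> \<Delta>" for \<Delta>
  proof -
    have "\<phi> \<in> \<Delta> \<and> \<psi> \<in> \<Delta>" using that saturatedD(6) unfolding refuted_def by blast
    then show ?thesis using that(1) Or.IH Or.prems by auto
  qed
  ultimately show ?case by blast
next
  case (Imp \<phi> \<psi>)
  have "csat y \<psi>" if "Imp \<phi> \<psi> \<in> th x" "y \<in> W" "th x \<subseteq> th y" "csat y \<phi>" for y
  proof -
    obtain \<Delta> where \<Delta>: "refuted (th y) \<Delta>" using th_refuted \<open>y \<in> W\<close> by blast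
    have "Imp \<phi> \<psi> \<in> th y" using that by blast
    then have "\<phi> \<in> \<Delta> \<or> \<psi> \<in> th y" using \<Delta> saturatedD(7) unfolding refuted_def by blast
    then show ?thesis using Imp.IH \<Delta> that(2,4) by blast
  qed
  moreover have "\<exists>y. y \<in> W \<and> th x \<subseteq> th y \<and> csat y \<phi> \<and> \<not> csat y \<psi>"
    if ref: "refuted (th x) \<Delta>" and "Imp \<phi> \<psi> \<in> \<Delta>" for \<Delta>
  proof -
    have sub: "th x \<subseteq> S" "\<Delta> \<subseteq> S" "\<phi> \<in> S" "\<psi> \<in> S"
      using that closedD[OF closed_S] unfolding refuted_def by blast+
    have "rule_instance R_ImpR [(unf ` insert \<phi> (th x), unf ` {\<psi>})] (unf ` th x, unf ` \<Delta>)"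
      using schema.intros(8)[of \<phi> "unf ` th x" \<psi> "unf ` \<Delta>"] finite_subset_S[OF sub(1)]
        finite_subset_S[OF sub(2)] that(2)
      unfolding rule_instance_def by (auto simp: insert_absorb unf_in_image)
    moreover have "R_ImpR \<in> R" using rules unfolding nICK_def by auto
    ultimately have "provable R (unf ` th x, unf ` \<Delta>)"
      if "provable R (unf ` insert \<phi> (th x), unf ` {\<psi>})"
      using provable_rule[of R_ImpR R "[(unf ` insert \<phi> (th x), unf ` {\<psi>})]"] that by simp
    then have "\<not> provable R (unf ` insert \<phi> (th x), unf ` {\<psi>})"
      using ref unfolding refuted_def by blast
    then obtain \<Gamma>' \<Delta>' where ext: "refuted \<Gamma>' \<Delta>'" "insert \<phi> (th x) \<subseteq> \<Gamma>'" "{\<psi>} \<subseteq> \<Delta>'"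
      using sub refuted_extension[of "insert \<phi> (th x)" "{\<psi>}"] by blast
    then obtain y where y: "y \<in> W" "th y = \<Gamma>'" using th_surj by blast
    then have "csat y \<phi>" "\<not> csat y \<psi>" using Imp.IH[of y] ext by simp_all
    then show ?thesis using y ext(2) by (intro exI[of _ y]) simp
  qed
  ultimately show ?case using Imp.prems by auto
next
  case (Know a \<phi>)
  have "csat y \<phi>" if "Know a \<phi> \<in> th x" "y \<in> W" "core a (th x) \<subseteq> th y" for y
  proof -
    obtain \<Delta> where "saturated R (th y) \<Delta>" using th_refuted \<open>y \<in> W\<close> unfolding refuted_def by blast
    then have "\<phi> \<in> th y" by (rule core_elim[OF that(1,3)])
    then show ?thesis using Know.IH[OF that(2)] by simp
  qed
  moreover have "\<exists>y. y \<in> W \<and> core a (th x) \<subseteq> th y \<and> \<not> csat y \<phi>"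
    if ref: "refuted (th x) \<Delta>" and "Know a \<phi> \<in> \<Delta>" for \<Delta>
  proof -
    have sub: "th x \<subseteq> S" "\<Delta> \<subseteq> S" "\<phi> \<in> S"
      using that closedD[OF closed_S] unfolding refuted_def by blast+
    have "\<exists>r\<in>R. rule_instance r [(unf ` core a (th x), {unf \<phi>})]
        (unf ` th x, insert (unf (Know a \<phi>)) (unf ` \<Delta>))"
      using sub finite_subset_S by (intro modal_rule_instance) auto
    moreover have "insert (unf (Know a \<phi>)) (unf ` \<Delta>) = unf ` \<Delta>"
      using that(2) by (simp add: insert_absorb unf_in_image)
    ultimately obtain r where "r \<in> R"
      "rule_instance r [(unf ` core a (th x), unf ` {\<phi>})] (unf ` th x, unf ` \<Delta>)" by auto
    then have "provable R (unf ` th x, unf ` \<Delta>)" if "provable R (unf ` core a (th x), unf ` {\<phi>})"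
      using provable_rule[of r R "[(unf ` core a (th x), unf ` {\<phi>})]"] that by simp
    then have "\<not> provable R (unf ` core a (th x), unf ` {\<phi>})"
      using ref unfolding refuted_def by blast
    then obtain \<Gamma>' \<Delta>' where ext: "refuted \<Gamma>' \<Delta>'" "core a (th x) \<subseteq> \<Gamma>'" "{\<phi>} \<subseteq> \<Delta>'"
      using sub core_in_S[OF sub(1)] refuted_extension[of "core a (th x)" "{\<phi>}"] by blast
    then obtain y where y: "y \<in> W" "th y = \<Gamma>'" using th_surj by blast
    then have "\<not> csat y \<phi>" using Know.IH[of y] ext(1,3) by simp
    then show ?thesis using y ext(2) by (intro exI[of _ y]) simp
  qed
  ultimately show ?case using Know.prems by auto
next
  case (Common \<phi>)
  have "csat y \<phi>" if C: "Common \<phi> \<in> th x" and "(x, y) \<in> (\<Union>a. acc canon a)\<^sup>*" for y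
  proof -
    \<comment> \<open>What travels along the path is membership of \<open>Common \<phi>\<close>:
      saturation yields \<open>Know a (Common \<phi>)\<close>, and \<open>core_elim\<close> hands
      \<open>Common \<phi>\<close> to the successor.\<close>
    have "y \<in> W \<and> Common \<phi> \<in> th y"
      using that(2)
    proof (induction rule: rtrancl_induct)
      case base
      then show ?case using C Common.prems by blast
    next
      case (step y z)
      then obtain a where yz: "z \<in> W" "core a (th y) \<subseteq> th z" by auto
      obtain \<Delta>\<^sub>0 where "saturated R (th y) \<Delta>\<^sub>0"
        using th_refuted step.IH unfolding refuted_def by blast
      then have "Know a (Common \<phi>) \<in> th y" using saturatedD(9) step.IH by metis
      moreover obtain \<Delta> where "saturated R (th z) \<Delta>"
        using th_refuted yz(1) unfolding refuted_def by blast
      ultimately show ?case using yz core_elim[of a "Common \<phi>" "th y" "th z"] by simp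
    qed
    then obtain \<Delta>\<^sub>0 where y: "y \<in> W" "Common \<phi> \<in> th y" and "saturated R (th y) \<Delta>\<^sub>0"
      using th_refuted[of y] unfolding refuted_def by blast
    then have "\<phi> \<in> th y" using saturatedD(9) by metis
    then show ?thesis using Common.IH[OF y(1)] by simp
  qed
  then show ?case using Common_refuted[of \<phi> x] Common by auto
qed

end

section \<open>Completeness\<close>

lemma set_enumeration: "finite A \<Longrightarrow> set (enumeration A) = A"
  unfolding enumeration_def using someI_ex[OF finite_distinct_list[of A]] by blast

lemma sat_Big_And: "finite A \<Longrightarrow> sat F V w (Big_And A) \<longleftrightarrow> (\<forall>\<phi>\<in>A. sat F V w \<phi>)"
proof -
  have "sat F V w (conj_list xs) \<longleftrightarrow> (\<forall>\<phi>\<in>set xs. sat F V w \<phi>)" for xs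
    by (induction xs rule: conj_list.induct) auto
  then show "finite A \<Longrightarrow> ?thesis" unfolding Big_And_def by (simp add: set_enumeration)
qed

lemma sat_Big_Or: "finite A \<Longrightarrow> sat F V w (Big_Or A) \<longleftrightarrow> (\<exists>\<phi>\<in>A. sat F V w \<phi>)"
proof -
  have "sat F V w (disj_list xs) \<longleftrightarrow> (\<exists>\<phi>\<in>set xs. sat F V w \<phi>)" for xs
    by (induction xs rule: disj_list.induct) auto
  then show "finite A \<Longrightarrow> ?thesis" unfolding Big_Or_def by (simp add: set_enumeration)
qed

text \<open>A sequent has at most one focused formula, so a single \<open>R_U\<close> reduces it to
  an unfocused sequent.\<close>

lemma provable_unfocus:
  fixes \<Gamma> \<Delta> :: "('p, 'a::finite) afm set"
  assumes R: "R_U \<in> R" and seq: "is_sequent (\<Gamma>, \<Delta>)"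
    and "provable R (unf ` fst ` \<Gamma>, unf ` fst ` \<Delta>)"
  shows "provable R (\<Gamma>, \<Delta>)"
proof -
  have unf: "unf ` fst ` A = A" if "\<forall>\<phi>. foc \<phi> \<notin> A" for A :: "('p, 'a) afm set"
  proof -
    have "(\<phi>, x) = unf \<phi>" if "(\<phi>, x) \<in> A" for \<phi> x
      using that \<open>\<forall>\<phi>. foc \<phi> \<notin> A\<close> by (cases x) auto
    then show ?thesis by force
  qed
  have \<Gamma>: "unf ` fst ` \<Gamma> = \<Gamma>" by (rule unf) (use seq in simp)
  show ?thesis
  proof (cases "\<exists>\<phi>. foc \<phi> \<in> \<Delta>")
    case False
    then show ?thesis using assms(3) \<Gamma> unf[of \<Delta>] by simp
  next
    case True
    then obtain \<phi> where \<phi>: "foc \<phi> \<in> \<Delta>" by blast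
    define \<Delta>' where "\<Delta>' = \<Delta> - {foc \<phi>}"
    have \<Delta>: "\<Delta> = insert (foc \<phi>) \<Delta>'" using \<phi> unfolding \<Delta>'_def by blast
    have "\<forall>\<psi>. foc \<psi> \<notin> \<Delta>'" using seq \<phi> unfolding \<Delta>'_def is_sequent.simps by blast
    then have "unf ` fst ` \<Delta> = insert (unf \<phi>) \<Delta>'" using unf[of \<Delta>'] unfolding \<Delta> by simp
    then have *: "provable R (\<Gamma>, insert (unf \<phi>) \<Delta>')" using assms(3) \<Gamma> by simp
    then have "rule_instance R_U [(\<Gamma>, insert (unf \<phi>) \<Delta>')] (\<Gamma>, \<Delta>)"
      using schema.intros(9)[of \<Gamma> \<phi> \<Delta>'] provable_is_sequent[OF *] seq
      unfolding rule_instance_def \<Delta> by (simp del: is_sequent.simps)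
    then show ?thesis by (rule provable_rule[OF R]) (use * in simp)
  qed
qed

text \<open>The modal rule enters only through \<open>core\<close>, and the class of frames only
  through membership of the canonical frame.\<close>

lemma completeness:
  fixes \<sigma> :: "('p, 'a::finite) sequent"
    and core :: "'a \<Rightarrow> ('p, 'a) fm set \<Rightarrow> ('p, 'a) fm set"
    and \<F> :: "('w, 'a) frame set"
  assumes inf: "infinite (UNIV :: 'w set)" and seq: "is_sequent \<sigma>" and valid: "valid \<F> \<sigma>"
    and calculus: "\<And>S. finite S \<Longrightarrow> closed S \<Longrightarrow> calculus R core S"
    and frame: "\<And>S W (th :: 'w \<Rightarrow> _). canonical_model R core S W th \<Longrightarrow>
      canonical_model.canon core W th \<in> \<F>"
  shows "\<exists>t. nwf_proof R \<sigma> t"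
proof (rule ccontr)
  assume not_provable: "\<not> ?thesis"
  obtain \<Gamma> \<Delta> where \<sigma>: "\<sigma> = (\<Gamma>, \<Delta>)" by force
  define S where "S = (\<Union>\<phi>\<in>fst ` (\<Gamma> \<union> \<Delta>). closure \<phi>)"
  have fin: "finite \<Gamma>" "finite \<Delta>" using seq \<sigma> by auto
  have "finite S" unfolding S_def using fin by (simp add: finite_closure)
  have "closed S" unfolding S_def by (rule closed_UN_closure)
  have sub: "fst ` \<Gamma> \<subseteq> S" "fst ` \<Delta> \<subseteq> S"
    unfolding S_def using self_in_closure by blast+
  interpret calculus R core S by (rule calculus) fact+
  have "R_U \<in> R" using rules unfolding nICK_def by auto
  then have "\<not> provable R (unf ` fst ` \<Gamma>, unf ` fst ` \<Delta>)"
    using not_provable provable_unfocus seq unfolding \<sigma> provable_def by blast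
  then obtain \<Gamma>' \<Delta>' where ref: "refuted \<Gamma>' \<Delta>'" "fst ` \<Gamma> \<subseteq> \<Gamma>'" "fst ` \<Delta> \<subseteq> \<Delta>'"
    using refuted_extension[OF sub] by blast
  let ?T = "{\<Gamma>. \<exists>\<Delta>. refuted \<Gamma> \<Delta>}"
  have "?T \<subseteq> Pow S" unfolding refuted_def by auto
  then have "finite ?T" using \<open>finite S\<close> finite_subset by blast
  \<comment> \<open>There are only finitely many left-hand sides over \<open>S\<close>, so an
    infinite type has room for a copy of them.\<close>
  then obtain W :: "'w set" where "finite W" "card W = card ?T"
    using infinite_arbitrarily_large[OF inf] by blast
  then obtain th where th: "bij_betw th W ?T"
    using \<open>finite ?T\<close> finite_same_card_bij by blast
  then have "W \<noteq> {}" using ref(1) unfolding bij_betw_def by blast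
  then interpret canonical_model R core S W th using th by unfold_locales
  have "canon \<in> \<F>" by (rule frame) (rule canonical_model_axioms)
  obtain x where x: "x \<in> W" "th x = \<Gamma>'" using th_surj[OF ref(1)] by blast
  have "csat x (Imp (Big_And (fst ` \<Gamma>)) (Big_Or (fst ` \<Delta>)))"
    using valid \<open>canon \<in> \<F>\<close> val_monotone x(1) unfolding \<sigma> valid.simps valid_fm_def by (simp del: sat.simps)
  moreover have "csat x (Big_And (fst ` \<Gamma>))"
    unfolding sat_Big_And[OF finite_imageI[OF fin(1)]] using truth[OF x(1)] x(2) ref(2) by blast
  ultimately have "csat x (Big_Or (fst ` \<Delta>))" using x(1) by simp
  then show False
    unfolding sat_Big_Or[OF finite_imageI[OF fin(2)]] using truth[OF x(1)] x(2) ref(1,3) by blast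
qed

section \<open>The three calculi and their frame classes\<close>

lemma calculus_K:
  fixes S :: "('p, 'a::finite) fm set"
  assumes "nICK \<subseteq> R" "finite S" "closed S"
  shows "calculus R (\<lambda>a \<Gamma>. {\<psi>. Know a \<psi> \<in> \<Gamma>}) S"
proof
  fix a x \<phi> and \<Gamma> :: "('p, 'a) fm set" and \<Sigma> :: "('p, 'a) afm set"
  \<comment> \<open>The weakening context \<open>\<Pi>\<close> is taken to be the whole left-hand
    side, which absorbs the boxed formulae.\<close>
  have "unf ` \<Gamma> \<union> Know_set a (unf ` {\<psi>. Know a \<psi> \<in> \<Gamma>}) = unf ` \<Gamma>" unfolding Know_set_def by auto
  then have "schema R_K [(unf ` {\<psi>. Know a \<psi> \<in> \<Gamma>}, {(\<phi>, x)})] (unf ` \<Gamma>, insert (Know a \<phi>, x) \<Sigma>)"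
    using schema.intros(11)[of "unf ` {\<psi>. Know a \<psi> \<in> \<Gamma>}" \<phi> x "unf ` \<Gamma>" a \<Sigma>] by simp
  moreover have "R_K \<in> R" using assms(1) unfolding nICK_def by auto
  ultimately show "\<exists>r\<in>R. schema r [(unf ` {\<psi>. Know a \<psi> \<in> \<Gamma>}, {(\<phi>, x)})]
      (unf ` \<Gamma>, insert (Know a \<phi>, x) \<Sigma>)" by blast
qed (use assms in auto)

text \<open>\<open>R_S4\<close> keeps the boxes, so \<open>core\<close> passes on
  \<open>Know a \<psi>\<close> itself and the successor recovers \<open>\<psi>\<close> by saturation
  under \<open>R_T\<close>.\<close>

lemma calculus_S4:
  fixes S :: "('p, 'a::finite) fm set"
  assumes "finite S" "closed S"
  shows "calculus nICKS4 (\<lambda>a \<Gamma>. \<Gamma> \<inter> range (Know a)) S"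
proof
  fix a x \<phi> and \<Gamma> :: "('p, 'a) fm set" and \<Sigma> :: "('p, 'a) afm set"
  have "Know_set a (unf ` {\<psi>. Know a \<psi> \<in> \<Gamma>}) = unf ` (\<Gamma> \<inter> range (Know a))"
    unfolding Know_set_def by auto
  moreover from this have "unf ` \<Gamma> \<union> Know_set a (unf ` {\<psi>. Know a \<psi> \<in> \<Gamma>}) = unf ` \<Gamma>" by auto
  ultimately have "schema R_S4 [(unf ` (\<Gamma> \<inter> range (Know a)), {(\<phi>, x)})]
      (unf ` \<Gamma>, insert (Know a \<phi>, x) \<Sigma>)"
    using schema.intros(13)[of a "unf ` {\<psi>. Know a \<psi> \<in> \<Gamma>}" \<phi> x "unf ` \<Gamma>" \<Sigma>] by simp
  then show "\<exists>r\<in>nICKS4. schema r [(unf ` (\<Gamma> \<inter> range (Know a)), {(\<phi>, x)})]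
      (unf ` \<Gamma>, insert (Know a \<phi>, x) \<Sigma>)" unfolding nICKS4_def by blast
next
  fix a \<psi> and \<Gamma> \<Gamma>' \<Delta>' :: "('p, 'a) fm set"
  assume "Know a \<psi> \<in> \<Gamma>" "\<Gamma> \<inter> range (Know a) \<subseteq> \<Gamma>'" "saturated nICKS4 \<Gamma>' \<Delta>'"
  moreover have "R_T \<in> nICKS4" unfolding nICKS4_def nICKT_def by simp
  ultimately show "\<psi> \<in> \<Gamma>'" using saturatedD(8)[of nICKS4 \<Gamma>' \<Delta>' a \<psi>] by blast
qed (use assms in \<open>auto simp: nICKS4_def nICKT_def\<close>)

theorem mainTheorem13:
  fixes \<sigma> :: "('p, 'a::finite) sequent"
  assumes "infinite (UNIV :: 'w set)"
    and "is_sequent \<sigma>"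
  shows "(valid (epistemic_frames :: ('w, 'a) frame set) \<sigma> \<longrightarrow> (\<exists>t. nwf_proof nICK \<sigma> t)) \<and>
         (valid (reflexive_frames :: ('w, 'a) frame set) \<sigma> \<longrightarrow> (\<exists>t. nwf_proof nICKT \<sigma> t)) \<and>
         (valid (S4_frames :: ('w, 'a) frame set) \<sigma> \<longrightarrow> (\<exists>t. nwf_proof nICKS4 \<sigma> t))"
proof (intro conjI impI)
  show "\<exists>t. nwf_proof nICK \<sigma> t" if "valid (epistemic_frames :: ('w, 'a) frame set) \<sigma>"
    by (rule completeness[OF assms that calculus_K]) (auto intro: canonical_model.canon_epistemic)
  show "\<exists>t. nwf_proof nICKT \<sigma> t" if "valid (reflexive_frames :: ('w, 'a) frame set) \<sigma>"
  proof (rule completeness[OF assms that calculus_K])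
    fix S :: "('p, 'a) fm set" and W and th :: "'w \<Rightarrow> ('p, 'a) fm set"
    let ?core = "\<lambda>a \<Gamma>. {\<psi>. Know a \<psi> \<in> \<Gamma>} :: ('p, 'a) fm set"
    assume "canonical_model nICKT ?core S W th"
    then interpret canonical_model nICKT ?core S W th .
    \<comment> \<open>Saturation under \<open>R_T\<close> is what makes each world accessible from
      itself.\<close>
    have "?core a (th x) \<subseteq> th x" if "x \<in> W" for a x
    proof -
      obtain \<Delta> where "saturated nICKT (th x) \<Delta>"
        using th_refuted[OF \<open>x \<in> W\<close>] unfolding refuted_def by blast
      moreover have "R_T \<in> nICKT" unfolding nICKT_def by simp
      ultimately show ?thesis using saturatedD(8)[of nICKT "th x" \<Delta> a] by blast
    qed
    then show "canon \<in> reflexive_frames"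
      using canon_epistemic unfolding reflexive_frames_def by (auto simp: refl_on_def)
  qed (auto simp: nICKT_def)
  show "\<exists>t. nwf_proof nICKS4 \<sigma> t" if "valid (S4_frames :: ('w, 'a) frame set) \<sigma>"
  proof (rule completeness[OF assms that calculus_S4])
    fix S :: "('p, 'a) fm set" and W and th :: "'w \<Rightarrow> ('p, 'a) fm set"
    let ?core = "\<lambda>a \<Gamma>. \<Gamma> \<inter> range (Know a) :: ('p, 'a) fm set"
    assume "canonical_model nICKS4 ?core S W th"
    then interpret canonical_model nICKS4 ?core S W th .
    \<comment> \<open>Here \<open>?core\<close> selects a part of its argument, which gives
      reflexivity. A boxed formula handed to a successor lies in the core of that successor again,
      which gives transitivity.\<close>
    have "refl_on W (acc canon a)" for a by (auto simp: refl_on_def)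
    moreover have "trans (acc canon a)" for a unfolding trans_def canon_simps by blast
    ultimately show "canon \<in> S4_frames"
      using canon_epistemic unfolding S4_frames_def by auto
  qed
qed

end
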